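(* Let $G$ be a probability distribution on $[0,\infty)$, let $\boldsymbol X=(X_0,X_1,\dots)$ be a homogeneous Markov chain on $[0,\infty)$ with transition kernel $K\in D(G)$, with extremal component $\boldsymbol X^{(t)}$ relative to $t$ (defined using a uniform extremal boundary $y(t)$ for $K$). Let $m\ge 1$, write $\boldsymbol X_m=(X_1,\dots,X_m)$ and $\boldsymbol X^{(t)}_m=(X^{(t)}_1,\dots,X^{(t)}_m)$, and let $\rho$ be a metric on $\mathbb R^m$. If $y(t)\equiv 0$ is an extremal boundary for $K$, or if $K$ satisfies the regularity condition, then for any $\epsilon>0$ and any non-negative function $u_t=u(t)$ with $u_t\to u>0$, $$\mathsf P_{tu_t}\Big[\rho\Big(\frac{\boldsymbol X^{(t)}_m}{t},\frac{\boldsymbol X_m}{t}\Big)>\epsilon\Big]\longrightarrow0\qquad(t\to\infty).$$ Consequently, for any non-negative function $u_t\to u>0$, $$\mathsf P_{tu_t}\Big[\Big(\tfrac{X_1}{t},\dots,\tfrac{X_m}{t}\Big)\in\cdot\,\Big]\Rightarrow\mathsf P_u\big[(T^*_1,\dots,T^*_m)\in\cdot\,\big]\quad\text{on }[0,\infty]^m\qquad(t\to\infty),$$ where $T^*_n=T^*_0\,\xi_1\cdots\xi_n$ with $\xi_1,\xi_2,\dots$ iid with distribution $G$ and independent of $T_0^*$.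
   Context: A Markov transition kernel $K:[0,\infty)\times\mathcal B[0,\infty)\to[0,1]$ is in the domain of attraction of $G$, written $K\in D(G)$, if $K(t,t\,\cdot)\Rightarrow G(\cdot)$ on $[0,\infty]$ as $t\to\infty$ (weak convergence; $tA=\{ta:a\in A\}$). $K\in D(G)$ satisfies the regularity condition if $K(tu_t,t\,\cdot)\Rightarrow\epsilon_0$ on $[0,\infty]$ as $t\to\infty$ for every non-negative function $u_t\to0$, where $\epsilon_0$ is the point mass at $0$. An extremal boundary for $K\in D(G)$ is a non-negative function $y(t)$ on $[0,\infty)$ with $\lim_{t\to\infty}y(t)=0$ and $K(t,t[0,y(t)])\to G(\{0\})$ as $t\to\infty$; it is a uniform extremal boundary if moreover $K(tu_t,t[0,y(t)])\to G(\{0\})$ for every non-negative function $u_t\to u>0$. Put $\tau(t)=\inf\{n\ge0:X_n\le t\,y(t)\}$; the extremal component of $\boldsymbol X$ relative to $t>0$ is $X^{(t)}_n=X_n\mathbf 1_{\{n<\tau(t)\}}$, $n\ge0$. $\mathsf P_x$ denotes conditional probability given that the initial state ($X_0$ or $T_0^*$) equals $x$.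
   Formalization: The metric ρ on ℝ^m is required to induce the usual Euclidean topology; for an arbitrary metric, such as the discrete one, the first convergence can fail (take K(0,·) the point mass at 1, G({0})>0, y≡0, m=2). *)

theory Defs
  imports "HOL-Probability.Probability"
begin

abbreviation halfline :: "real measure" where
  "halfline \<equiv> restrict_space borel {0..}"

definition weak_convergence_on ::
  "'a topology \<Rightarrow> ('b \<Rightarrow> 'a measure) \<Rightarrow> 'a measure \<Rightarrow> 'b filter \<Rightarrow> bool" where
  "weak_convergence_on S \<mu> \<nu> F \<longleftrightarrow>
     (\<forall>f :: 'a \<Rightarrow> real. continuous_map S euclideanreal f \<and> bounded (f ` topspace S) \<longrightarrow>
        ((\<lambda>t. \<integral>x. f x \<partial>\<mu> t) \<longlongrightarrow> (\<integral>x. f x \<partial>\<nu>)) F)"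

text \<open>The measure $K(s, t\,\cdot)$ for $t > 0$, carried to $[0,\infty]$, which is the type
  \<^typ>\<open>ennreal\<close> with its order topology.\<close>

definition scaled_kernel :: "(real \<Rightarrow> real measure) \<Rightarrow> real \<Rightarrow> real \<Rightarrow> ennreal measure" where
  "scaled_kernel K s t = distr (K s) borel (\<lambda>x. ennreal (x / t))"

definition in_domain_of_attraction :: "(real \<Rightarrow> real measure) \<Rightarrow> real measure \<Rightarrow> bool" where
  "in_domain_of_attraction K G \<longleftrightarrow>
     weak_convergence_on euclidean (\<lambda>t. scaled_kernel K t t) (distr G borel ennreal) at_top"

definition regularity_condition :: "(real \<Rightarrow> real measure) \<Rightarrow> bool" where
  "regularity_condition K \<longleftrightarrow>
     (\<forall>u. (\<forall>t\<ge>0. 0 \<le> u t) \<and> (u \<longlongrightarrow> 0) at_top \<longrightarrow>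
        weak_convergence_on euclidean (\<lambda>t. scaled_kernel K (t * u t) t) (return borel 0) at_top)"

definition extremal_boundary ::
  "(real \<Rightarrow> real measure) \<Rightarrow> real measure \<Rightarrow> (real \<Rightarrow> real) \<Rightarrow> bool" where
  "extremal_boundary K G y \<longleftrightarrow>
     (\<forall>t\<ge>0. 0 \<le> y t) \<and> (y \<longlongrightarrow> 0) at_top \<and>
     ((\<lambda>t. measure (K t) ((*) t ` {0..y t})) \<longlongrightarrow> measure G {0}) at_top"

definition uniform_extremal_boundary ::
  "(real \<Rightarrow> real measure) \<Rightarrow> real measure \<Rightarrow> (real \<Rightarrow> real) \<Rightarrow> bool" where
  "uniform_extremal_boundary K G y \<longleftrightarrow>
     extremal_boundary K G y \<and>
     (\<forall>u u\<^sub>0. (\<forall>t\<ge>0. 0 \<le> u t) \<and> 0 < u\<^sub>0 \<and> (u \<longlongrightarrow> u\<^sub>0) at_top \<longrightarrow>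
        ((\<lambda>t. measure (K (t * u t)) ((*) t ` {0..y t})) \<longlongrightarrow> measure G {0}) at_top)"

text \<open>The Markov property is taken with respect to the natural filtration: the conditioning
  \<open>\<sigma>\<close>-algebra below is the one generated by $X_0, \dots, X_n$.\<close>

definition markov_chain ::
  "'w measure \<Rightarrow> 'a measure \<Rightarrow> ('a \<Rightarrow> 'a measure) \<Rightarrow> (nat \<Rightarrow> 'w \<Rightarrow> 'a) \<Rightarrow> bool" where
  "markov_chain M S K X \<longleftrightarrow>
     prob_space M \<and> (\<forall>n. X n \<in> M \<rightarrow>\<^sub>M S) \<and>
     (\<forall>n. \<forall>A\<in>sets S. AE \<omega> in M.
        real_cond_exp M
          (vimage_algebra (space M) (\<lambda>\<omega>. \<lambda>i\<in>{..n}. X i \<omega>) (\<Pi>\<^sub>M i\<in>{..n}. S))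
          (\<lambda>\<omega>. indicator A (X (Suc n) \<omega>)) \<omega>
        = measure (K (X n \<omega>)) A)"

text \<open>Conditioning on the initial state is rendered by a family of probability measures
  \<open>P x\<close>, \<open>x \<ge> 0\<close>, under each of which the chain starts at \<open>x\<close>. This fixes the conditional law
  given $X_0 = x$ for every \<open>x\<close>, and not just up to null sets of an initial distribution.\<close>

definition markov_family ::
  "(real \<Rightarrow> 'w measure) \<Rightarrow> (real \<Rightarrow> real measure) \<Rightarrow> (nat \<Rightarrow> 'w \<Rightarrow> real) \<Rightarrow> bool" where
  "markov_family P K X \<longleftrightarrow>
     (\<forall>x\<ge>0. markov_chain (P x) halfline K X \<and> (AE \<omega> in P x. X 0 \<omega> = x))"

text \<open>In the same way, \<open>Q x\<close> is the probability given $T^*_0 = x$. The independent family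
  consists of \<open>T\<^sub>0\<close> at index \<open>0\<close> and of \<open>\<xi> n\<close> at the indices \<open>n \<ge> 1\<close>; \<open>\<xi> 0\<close> is not used.\<close>

definition tail_chain_family ::
  "(real \<Rightarrow> 'v measure) \<Rightarrow> real measure \<Rightarrow> ('v \<Rightarrow> real) \<Rightarrow> (nat \<Rightarrow> 'v \<Rightarrow> real) \<Rightarrow> bool" where
  "tail_chain_family Q G T\<^sub>0 \<xi> \<longleftrightarrow>
     (\<forall>x\<ge>0. prob_space (Q x) \<and>
        prob_space.indep_vars (Q x) (\<lambda>_. halfline) (\<lambda>n. if n = 0 then T\<^sub>0 else \<xi> n) UNIV \<and>
        (\<forall>n\<ge>1. distr (Q x) halfline (\<xi> n) = G) \<and>
        (AE \<omega> in Q x. T\<^sub>0 \<omega> = x))"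

definition tail_chain ::
  "('v \<Rightarrow> real) \<Rightarrow> (nat \<Rightarrow> 'v \<Rightarrow> real) \<Rightarrow> nat \<Rightarrow> 'v \<Rightarrow> real" where
  "tail_chain T\<^sub>0 \<xi> n \<omega> = T\<^sub>0 \<omega> * (\<Prod>j=1..n. \<xi> j \<omega>)"

text \<open>The time is \<open>\<infinity>\<close> if the chain never reaches the boundary.\<close>

definition extremal_time ::
  "(real \<Rightarrow> real) \<Rightarrow> (nat \<Rightarrow> 'w \<Rightarrow> real) \<Rightarrow> real \<Rightarrow> 'w \<Rightarrow> enat" where
  "extremal_time y X t \<omega> = Inf {enat n | n. X n \<omega> \<le> t * y t}"

definition extremal_component ::
  "(real \<Rightarrow> real) \<Rightarrow> (nat \<Rightarrow> 'w \<Rightarrow> real) \<Rightarrow> real \<Rightarrow> nat \<Rightarrow> 'w \<Rightarrow> real" where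
  "extremal_component y X t n \<omega> = X n \<omega> * of_bool (enat n < extremal_time y X t \<omega>)"

text \<open>\<open>\<real>\<^sup>m\<close> is represented by the extensional functions on \<open>{1..m}\<close>. A metric on it is required to
  induce the Euclidean topology; the theorem is false for the discrete metric, for example.\<close>

definition euclidean_compatible_metric ::
  "nat \<Rightarrow> ((nat \<Rightarrow> real) \<Rightarrow> (nat \<Rightarrow> real) \<Rightarrow> real) \<Rightarrow> bool" where
  "euclidean_compatible_metric m \<rho> \<longleftrightarrow>
     Metric_space ({1..m} \<rightarrow>\<^sub>E UNIV) \<rho> \<and>
     Metric_space.mtopology ({1..m} \<rightarrow>\<^sub>E UNIV) \<rho> = product_topology (\<lambda>_. euclideanreal) {1..m}"

end

theory Submission
  imports Defs
begin

text \<open>By the Markov property, the expectation of a product of test functions of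
  $X_1/t, \dots, X_m/t$ is an iterated kernel integral. Peeling off one kernel at a time, it converges
  because $h_t \to h$ continuously and $\mu_t \Rightarrow \mu$ imply $\int h_t\,d\mu_t \to \int h\,d\mu$.
  The only delicate point is the state \<open>0\<close>. The regularity condition gives continuous convergence
  there. If $y \equiv 0$ is an extremal boundary, the mass near \<open>0\<close> is asymptotically the mass at \<open>0\<close>
  itself, and from a fixed state the chain stays of order less than \<open>t\<close> for free. Products of test
  functions determine weak convergence on $[0,\infty]^m$ by the Stone--Weierstrass theorem.

  The statement about the extremal component follows from the weak convergence: the two vectors
  differ only after the chain has dropped below $t\,y(t)$ with $y(t) \to 0$, and since the limit
  chain is absorbed at \<open>0\<close>, returning from there to order \<open>t\<close> has vanishing probability.\<close>

section \<open>Weak convergence on powers of the extended half-line\<close>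

text \<open>The domain of attraction controls a step only on the scale of its own starting point. A
  step from \<open>t * u t\<close> is therefore rescaled by \<open>t * u t\<close>, which makes
  sense as long as \<open>u t\<close> stays away from 0; the factor \<open>u t\<close> leads back to
  scale \<open>t\<close>. The induction over the number of steps must hence carry convergence along
  every sequence of starting points with positive limit. It loses control exactly when the path
  drops below order \<open>t\<close>, which keeps positive probability in the limit if
  \<open>G\<close> has an atom at 0. With y = 0 as an extremal boundary nothing is known about
  transitions from small nonzero states. It suffices that they are rarely visited: if the mass at 0
  converges to the atom of the limit, then, for almost surely convergent versions, the event that
  the limit is 0 while the approximation is not has vanishing probability. Test functions on
  [0,\<infinity>]^m see infinity as an ordinary point, and \<open>\<rho>\<close> need not be
  uniformly comparable with the Euclidean metric. Tightness, which comes from the limit chain being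
  finite, brings the comparison down to a compact box.\<close>

inductive product_span :: "'i set \<Rightarrow> (('i \<Rightarrow> real) \<Rightarrow> real) \<Rightarrow> bool" for I where
  prod: "(\<And>i. continuous_on UNIV (g i)) \<Longrightarrow> (\<And>i x. g i x \<in> {0..1}) \<Longrightarrow>
           product_span I (\<lambda>x. c * (\<Prod>i\<in>I. g i (x i)))"
| add: "product_span I f \<Longrightarrow> product_span I g \<Longrightarrow> product_span I (\<lambda>x. f x + g x)"

lemma product_span_const: "product_span I (\<lambda>_. c)"
  using product_span.prod[of "\<lambda>_ _. 1" I c] by simp

text \<open>The factors take values in [0,1], a class closed under products; sign and size sit in
  the separate constant \<open>c\<close>. This closure makes the span an algebra.\<close>

lemma product_span_mult:
  assumes "product_span I f" "product_span I g"
  shows "product_span I (\<lambda>x. f x * g x)"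
  using assms
proof (induction f rule: product_span.induct)
  case f: (prod g' c)
  from f.prems show ?case
  proof (induction g rule: product_span.induct)
    case (prod h d)
    have "product_span I (\<lambda>x. (c * d) * (\<Prod>i\<in>I. (\<lambda>z. g' i z * h i z) (x i)))"
      by (rule product_span.prod)
         (use f.hyps prod.hyps in \<open>auto intro!: continuous_intros mult_le_one\<close>)
    then show ?case by (simp add: prod.distrib mult_ac)
  next
    case (add h1 h2)
    then show ?case by (simp add: distrib_left product_span.add)
  qed
next
  case (add f1 f2)
  then show ?case by (simp add: distrib_right product_span.add)
qed

lemma product_span_continuous_on: "product_span I f \<Longrightarrow> continuous_on S f"
proof (induction f rule: product_span.induct)
  case (prod g c)
  have "continuous_on S (\<lambda>x. g i (x i))" for i
    by (rule continuous_on_compose2[OF prod(1)])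
       (auto intro: continuous_on_subset[OF continuous_on_product_coordinates])
  then show ?case by (intro continuous_intros)
qed (auto intro: continuous_intros)

lemma product_span_dense:
  fixes f :: "('i :: countable \<Rightarrow> real) \<Rightarrow> real"
  assumes "finite I" and f: "continuous_on (\<Pi>\<^sub>E i\<in>I. {0..1}) f" "e > 0"
  shows "\<exists>g. product_span I g \<and> (\<forall>x\<in>(\<Pi>\<^sub>E i\<in>I. {0..1}). \<bar>f x - g x\<bar> < e)"
proof (rule Stone_Weierstrass_HOL[OF _ _ _ _ _ _ f])
  \<comment> \<open>Extensionality turns the cube into a product over all indices whose factors off
    \<open>I\<close> are singletons, so its compactness is Tychonoff's theorem in the topology of
    the full function space.\<close>
  have S: "(\<Pi>\<^sub>E i\<in>I. {0..1::real}) = (\<Pi>\<^sub>E i\<in>UNIV. if i \<in> I then {0..1} else {undefined})"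
    by (auto simp: PiE_def Pi_def extensional_def)
  have "compactin (product_topology (\<lambda>_. euclideanreal) UNIV) (\<Pi>\<^sub>E i\<in>I. {0..1})"
    unfolding S compactin_PiE by auto
  then show "compact (\<Pi>\<^sub>E i\<in>I. {0..1::real})"
    by (simp add: euclidean_product_topology)
  show "\<exists>g. product_span I g \<and> g x \<noteq> g y"
    if xy: "x \<in> (\<Pi>\<^sub>E i\<in>I. {0..1}) \<and> y \<in> (\<Pi>\<^sub>E i\<in>I. {0..1}) \<and> x \<noteq> y" for x y :: "'i \<Rightarrow> real"
  proof -
    obtain j where j: "j \<in> I" "x j \<noteq> y j" using xy by (metis PiE_ext)
    \<comment> \<open>Coordinate \<open>j\<close> clamped to [0,1]: on the cube it is the coordinate
      itself, and off the cube it keeps the range that \<open>product_span\<close> demands.\<close>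
    define k :: "'i \<Rightarrow> real \<Rightarrow> real" where
      "k i z = (if i = j then max 0 (min 1 z) else 1)" for i z
    have "product_span I (\<lambda>x. 1 * (\<Prod>i\<in>I. k i (x i)))"
    proof (rule product_span.prod)
      show "continuous_on UNIV (k i)" for i
        by (cases "i = j") (auto simp: k_def[abs_def] intro!: continuous_intros)
    qed (auto simp: k_def)
    moreover have "(\<Prod>i\<in>I. k i (z i)) = z j" if "z \<in> (\<Pi>\<^sub>E i\<in>I. {0..1})" for z
    proof -
      have "(\<Prod>i\<in>I. k i (z i)) = (\<Prod>i\<in>I. if i = j then z j else 1)"
        using that j by (intro prod.cong) (auto simp: k_def PiE_iff)
      then show ?thesis using j \<open>finite I\<close> by simp
    qed
    ultimately show ?thesis using xy j by (intro exI[of _ "\<lambda>x. 1 * (\<Prod>i\<in>I. k i (x i))"]) auto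
  qed
qed (auto intro: product_span_const product_span_continuous_on product_span.add product_span_mult)

section \<open>The homeomorphism x -> 1 / (1 + x) of [0,\<infinity>] onto [0,1]\<close>

definition compactify :: "ennreal \<Rightarrow> real" where
  "compactify x = enn2real (inverse (1 + x))"

lemma compactify_simps [simp]:
  "r \<ge> 0 \<Longrightarrow> compactify (ennreal r) = 1 / (1 + r)" "compactify \<top> = 0"
proof -
  assume "r \<ge> 0"
  then have "inverse (1 + ennreal r) = ennreal (1 / (1 + r))"
    by (simp add: inverse_ennreal inverse_eq_divide flip: ennreal_1 ennreal_plus)
  with \<open>r \<ge> 0\<close> show "compactify (ennreal r) = 1 / (1 + r)"
    by (simp add: compactify_def)
qed (simp add: compactify_def)

lemma continuous_on_compactify: "continuous_on S compactify"
proof -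
  have *: "continuous_on UNIV (\<lambda>x::ennreal. inverse (1 + x))"
    by (intro continuous_intros continuous_on_add_ennreal)
  have "ennreal (compactify x) = inverse (1 + x)" for x
    unfolding compactify_def by (rule ennreal_enn2real) (simp add: less_top[symmetric])
  with * have "((\<lambda>z. inverse (1 + z)) \<longlongrightarrow> ennreal (compactify x)) (at x)" for x
    by (simp add: continuous_on_def)
  from tendsto_enn2real[OF this] have "continuous_on UNIV compactify"
    unfolding continuous_on_def by (simp add: compactify_def[abs_def])
  then show ?thesis by (rule continuous_on_subset) simp
qed

lemma inj_compactify: "inj compactify"
proof (rule injI)
  fix x y assume "compactify x = compactify y"
  then show "x = y"
    by (cases x rule: ennreal_cases; cases y rule: ennreal_cases) (auto simp: divide_simps)
qed

lemma range_compactify: "range compactify = {0..1}"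
proof (intro equalityI subsetI)
  fix x assume "x \<in> range compactify"
  then obtain z where "x = compactify z" by auto
  then show "x \<in> {0..1}" by (cases z rule: ennreal_cases) auto
next
  fix x :: real assume x: "x \<in> {0..1}"
  show "x \<in> range compactify"
  proof (cases "x = 0")
    case True
    then show ?thesis by (intro range_eqI[of _ _ \<top>]) simp
  next
    case False
    then show ?thesis using x by (intro range_eqI[of _ _ "ennreal (1 / x - 1)"]) (simp add: field_simps)
  qed
qed

lemma inv_compactify [simp]: "inv compactify (compactify x) = x"
  by (simp add: inj_compactify)

text \<open>A continuous injection of a compact space has a continuous inverse on its range.\<close>

lemma continuous_on_inv_compactify: "continuous_on {0..1} (inv compactify)"
  using continuous_on_inv[OF continuous_on_compactify Extended_Real_Limits.compact_UNIV]
  by (simp add: range_compactify)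

text \<open>Conjugation with \<open>compactify\<close> moves \<open>f\<close> to the real cube,
  where the span is dense. The estimate is confined to extensional functions because only they are
  points of the product space over \<open>I\<close>.\<close>

lemma product_test_functions_approximate:
  fixes f :: "('i :: countable \<Rightarrow> ennreal) \<Rightarrow> real"
  assumes "finite I" and f: "continuous_map (product_topology (\<lambda>_. euclidean) I) euclideanreal f"
    and "e > 0"
  obtains g where "product_span I g"
    and "\<And>x. x \<in> extensional I \<Longrightarrow> \<bar>f x - g (\<lambda>i\<in>I. compactify (x i))\<bar> < e"
proof -
  let ?S = "\<Pi>\<^sub>E i\<in>I. {0..1::real}"
  define h where "h r = (\<lambda>i\<in>I. inv compactify (r i))" for r
  have "continuous_on ?S (\<lambda>r. inv compactify (r i))" if "i \<in> I" for i
    by (rule continuous_on_compose2[OF continuous_on_inv_compactify])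
       (use that in \<open>auto intro: continuous_on_subset[OF continuous_on_product_coordinates]\<close>)
  then have "continuous_map (top_of_set ?S) (product_topology (\<lambda>_. euclidean) I) h"
    by (auto simp: continuous_map_componentwise h_def)
  from continuous_map_compose[OF this f] have "continuous_on ?S (f \<circ> h)" by simp
  from product_span_dense[OF \<open>finite I\<close> this \<open>e > 0\<close>] obtain g where
    g: "product_span I g" "\<forall>x\<in>?S. \<bar>(f \<circ> h) x - g x\<bar> < e" by auto
  have "\<bar>f x - g (\<lambda>i\<in>I. compactify (x i))\<bar> < e" if "x \<in> extensional I" for x
  proof -
    have "(\<lambda>i\<in>I. compactify (x i)) \<in> ?S" using range_compactify by auto
    moreover have "h (\<lambda>i\<in>I. compactify (x i)) = x"
      using that by (auto simp: h_def fun_eq_iff extensional_def)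
    ultimately show ?thesis using g(2) by fastforce
  qed
  with g(1) show ?thesis by (rule that)
qed

text \<open>Integrals are linear and bounded in the test function, so convergence on products passes
  to their span and from there, by uniform approximation, to all continuous functions. The
  hypothesis on \<open>\<mu>\<close> is eventual because the laws in question are known to be
  probability measures only for nonnegative \<open>t\<close>.\<close>

lemma weak_convergence_on_PiM_ennreal:
  fixes \<mu> :: "'b \<Rightarrow> ('i :: countable \<Rightarrow> ennreal) measure"
  assumes "finite I"
    and \<mu>: "\<forall>\<^sub>F t in F. prob_space (\<mu> t) \<and> sets (\<mu> t) = sets (\<Pi>\<^sub>M i\<in>I. borel)"
    and \<nu>: "prob_space \<nu>" "sets \<nu> = sets (\<Pi>\<^sub>M i\<in>I. borel)"
    and lim: "\<And>g :: 'i \<Rightarrow> ennreal \<Rightarrow> real. (\<And>i. continuous_on UNIV (g i)) \<Longrightarrow> (\<And>i x. g i x \<in> {0..1}) \<Longrightarrow>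
      ((\<lambda>t. \<integral>x. (\<Prod>i\<in>I. g i (x i)) \<partial>\<mu> t) \<longlongrightarrow> (\<integral>x. (\<Prod>i\<in>I. g i (x i)) \<partial>\<nu>)) F"
  shows "weak_convergence_on (product_topology (\<lambda>_. euclidean) I) \<mu> \<nu> F"
  unfolding weak_convergence_on_def
proof (intro allI impI, elim conjE)
  fix f :: "('i \<Rightarrow> ennreal) \<Rightarrow> real"
  let ?\<Pi> = "\<Pi>\<^sub>M i\<in>I. (borel :: ennreal measure)"
  let ?T = "product_topology (\<lambda>_. euclidean :: ennreal topology) I"
  assume f: "continuous_map ?T euclideanreal f" and "bounded (f ` topspace ?T)"
  then obtain B where B: "\<And>x. x \<in> extensional I \<Longrightarrow> \<bar>f x\<bar> \<le> B"
    unfolding bounded_iff by (auto simp: PiE_def)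
  define q where "q g x = g (\<lambda>i\<in>I. compactify (x i))" for g :: "('i \<Rightarrow> real) \<Rightarrow> real" and x
  have space: "space ?\<Pi> = extensional I" by (simp add: space_PiM PiE_def)
  have ext: "x \<in> space M \<longleftrightarrow> x \<in> extensional I" if "sets M = sets ?\<Pi>" for M x
    using sets_eq_imp_space_eq[OF that] space by simp
  have [measurable]: "compactify \<in> borel_measurable borel"
    by (rule borel_measurable_continuous_onI[OF continuous_on_compactify])
  \<comment> \<open>Measurability, a bound and convergence are carried together, since adding two
    integrals requires integrability.\<close>
  have span: "q g \<in> borel_measurable ?\<Pi> \<and> (\<exists>C. \<forall>x. \<bar>q g x\<bar> \<le> C) \<and>
     ((\<lambda>t. \<integral>x. q g x \<partial>\<mu> t) \<longlongrightarrow> (\<integral>x. q g x \<partial>\<nu>)) F" if "product_span I g" for g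
    using that
  proof (induction g rule: product_span.induct)
    case (prod g c)
    have [measurable]: "g i \<in> borel_measurable borel" for i
      by (rule borel_measurable_continuous_onI[OF prod(1)])
    have q: "q (\<lambda>x. c * (\<Prod>i\<in>I. g i (x i))) = (\<lambda>x. c * (\<Prod>i\<in>I. (g i \<circ> compactify) (x i)))"
      by (auto simp: q_def fun_eq_iff intro!: prod.cong)
    have "continuous_on UNIV (g i \<circ> compactify)" for i
      by (intro continuous_on_compose continuous_on_compactify continuous_on_subset[OF prod(1)]) auto
    then have "((\<lambda>t. \<integral>x. (\<Prod>i\<in>I. (g i \<circ> compactify) (x i)) \<partial>\<mu> t) \<longlongrightarrow> (\<integral>x. (\<Prod>i\<in>I. (g i \<circ> compactify) (x i)) \<partial>\<nu>)) F"
      using prod(2) by (intro lim[of "\<lambda>i. g i \<circ> compactify"]) auto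
    moreover have "\<bar>c * (\<Prod>i\<in>I. (g i \<circ> compactify) (x i))\<bar> \<le> \<bar>c\<bar>" for x
      using prod(2) by (auto simp: abs_mult abs_prod intro!: mult_right_le_one_le prod_le_1 prod_nonneg)
    moreover have "(\<lambda>x. c * (\<Prod>i\<in>I. (g i \<circ> compactify) (x i))) \<in> borel_measurable ?\<Pi>"
    proof (intro borel_measurable_times borel_measurable_const borel_measurable_prod)
      fix i assume "i \<in> I"
      then have "(\<lambda>x. x i) \<in> ?\<Pi> \<rightarrow>\<^sub>M borel" by (rule measurable_component_singleton)
      then show "(\<lambda>x. (g i \<circ> compactify) (x i)) \<in> borel_measurable ?\<Pi>"
        unfolding comp_def by measurable
    qed
    ultimately show ?case unfolding q by (auto intro!: tendsto_intros)
  next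
    case (add g h)
    then have [measurable]: "q g \<in> borel_measurable ?\<Pi>" "q h \<in> borel_measurable ?\<Pi>" by auto
    obtain C D where C: "\<And>x. \<bar>q g x\<bar> \<le> C" and D: "\<And>x. \<bar>q h x\<bar> \<le> D" using add by auto
    have q: "q (\<lambda>x. g x + h x) = (\<lambda>x. q g x + q h x)" by (simp add: q_def fun_eq_iff)
    have int: "(\<integral>x. q g x + q h x \<partial>M) = (\<integral>x. q g x \<partial>M) + (\<integral>x. q h x \<partial>M)"
      if "prob_space M" and [measurable_cong]: "sets M = sets ?\<Pi>" for M
    proof -
      interpret prob_space M by fact
      show ?thesis
        by (intro Bochner_Integration.integral_add integrable_const_bound[of _ C] integrable_const_bound[of _ D])
           (use C D in auto)
    qed
    have "\<forall>\<^sub>F t in F. (\<integral>x. q g x \<partial>\<mu> t) + (\<integral>x. q h x \<partial>\<mu> t) = (\<integral>x. q g x + q h x \<partial>\<mu> t)"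
      using \<mu> by eventually_elim (simp add: int)
    moreover have "((\<lambda>t. (\<integral>x. q g x \<partial>\<mu> t) + (\<integral>x. q h x \<partial>\<mu> t)) \<longlongrightarrow> (\<integral>x. q g x + q h x \<partial>\<nu>)) F"
      using add by (subst int[OF \<nu>]) (auto intro!: tendsto_intros)
    ultimately have "((\<lambda>t. \<integral>x. q g x + q h x \<partial>\<mu> t) \<longlongrightarrow> (\<integral>x. q g x + q h x \<partial>\<nu>)) F"
      by (rule Lim_transform_eventually[rotated])
    moreover have "\<bar>q g x + q h x\<bar> \<le> C + D" for x using C[of x] D[of x] by linarith
    ultimately show ?case unfolding q by auto
  qed
  have approx: "\<exists>g. product_span I g \<and> (\<forall>x\<in>extensional I. \<bar>f x - q g x\<bar> < e)" if "e > 0" for e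
    using product_test_functions_approximate[OF \<open>finite I\<close> f that] unfolding q_def by metis
  \<comment> \<open>Continuity for the product topology yields measurability for the product
    sigma-algebra because \<open>f\<close> is a uniform limit of members of the span.\<close>
  have [measurable]: "f \<in> borel_measurable ?\<Pi>"
  proof -
    have "\<forall>n. \<exists>g. product_span I g \<and> (\<forall>x\<in>extensional I. \<bar>f x - q g x\<bar> < 1 / Suc n)"
      using approx by simp
    then obtain g where g: "\<And>n. product_span I (g n)"
        "\<And>n x. x \<in> extensional I \<Longrightarrow> \<bar>f x - q (g n) x\<bar> < 1 / Suc n" by metis
    show ?thesis
    proof (rule borel_measurable_LIMSEQ_real)
      fix x assume "x \<in> space ?\<Pi>"
      then have "\<bar>q (g n) x - f x\<bar> \<le> 1 / Suc n" for n
        using g(2)[of x n] space by (simp add: abs_minus_commute)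
      then have "(\<lambda>n. q (g n) x - f x) \<longlonglongrightarrow> 0"
        by (intro Lim_null_comparison[OF _ LIMSEQ_inverse_real_of_nat])
           (auto simp: inverse_eq_divide)
      then show "(\<lambda>n. q (g n) x) \<longlonglongrightarrow> f x" by (simp add: LIM_zero_iff)
    qed (use span g in auto)
  qed
  show "((\<lambda>t. \<integral>x. f x \<partial>\<mu> t) \<longlongrightarrow> (\<integral>x. f x \<partial>\<nu>)) F"
  proof (rule tendstoI)
    fix e :: real assume "e > 0"
    then obtain g where g: "product_span I g" and fg: "\<And>x. x \<in> extensional I \<Longrightarrow> \<bar>f x - q g x\<bar> < e / 3"
      using approx[of "e / 3"] by auto
    from span[OF g] have [measurable]: "q g \<in> borel_measurable ?\<Pi>" by simp
    have diff: "\<bar>(\<integral>x. f x \<partial>M) - (\<integral>x. q g x \<partial>M)\<bar> \<le> e / 3"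
      if "prob_space M" and M[measurable_cong]: "sets M = sets ?\<Pi>" for M
    proof -
      interpret prob_space M by fact
      obtain C where C: "\<And>x. \<bar>q g x\<bar> \<le> C" using span[OF g] by auto
      have "(\<integral>x. f x \<partial>M) - (\<integral>x. q g x \<partial>M) = (\<integral>x. f x - q g x \<partial>M)"
        by (intro Bochner_Integration.integral_diff[symmetric] integrable_const_bound[of _ B] integrable_const_bound[of _ C])
           (use B C ext[OF M] in auto)
      also have "\<bar>\<dots>\<bar> \<le> (\<integral>x. \<bar>f x - q g x\<bar> \<partial>M)" by (rule integral_abs_bound)
      also have "\<dots> \<le> (\<integral>x. e / 3 \<partial>M)"
        using fg \<open>e > 0\<close> ext[OF M] by (intro integral_mono' integrable_const) (auto intro: less_imp_le)
      finally show ?thesis by (simp add: prob_space)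
    qed
    from span[OF g] have "\<forall>\<^sub>F t in F. dist (\<integral>x. q g x \<partial>\<mu> t) (\<integral>x. q g x \<partial>\<nu>) < e / 3"
      using \<open>e > 0\<close> by (intro tendstoD) auto
    with \<mu> show "\<forall>\<^sub>F t in F. dist (\<integral>x. f x \<partial>\<mu> t) (\<integral>x. f x \<partial>\<nu>) < e"
    proof eventually_elim
      case (elim t)
      then show ?case
        using diff[of "\<mu> t"] diff[OF \<nu>] unfolding dist_real_def by linarith
    qed
  qed
qed

section \<open>Extended continuous mapping\<close>

text \<open>Skorohod's theorem replaces the measures by almost surely convergent variables, which
  turns the claim into dominated convergence along the sequences \<open>Y n x\<close>. Positive
  limits are covered by \<open>pos\<close>. The disjunction \<open>zero\<close> says how a limit at
  0 is handled: by continuous convergence there as well, or by convergence of the atoms, in which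
  case \<open>h n\<close> is controlled at 0 itself only.\<close>

lemma extended_continuous_mapping:
  fixes M :: "nat \<Rightarrow> real measure" and h :: "nat \<Rightarrow> real \<Rightarrow> real"
  assumes M: "\<And>n. real_distribution (M n)" "real_distribution L" "weak_conv_m M L"
    and nonneg: "\<And>n. AE z in M n. 0 \<le> z" "AE z in L. 0 \<le> z"
    and h [measurable]: "\<And>n. h n \<in> borel_measurable borel" "h' \<in> borel_measurable borel"
    and bound: "\<And>n z. \<bar>h n z\<bar> \<le> B" "\<And>z. \<bar>h' z\<bar> \<le> B"
    and pos: "AE z in L. 0 < z \<longrightarrow> (\<forall>zs. (\<forall>n. 0 \<le> zs n) \<longrightarrow> zs \<longlonglongrightarrow> z \<longrightarrow> (\<lambda>n. h n (zs n)) \<longlonglongrightarrow> h' z)"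
    and zero: "(\<forall>zs. (\<forall>n. 0 \<le> zs n) \<longrightarrow> zs \<longlonglongrightarrow> 0 \<longrightarrow> (\<lambda>n. h n (zs n)) \<longlonglongrightarrow> h' 0) \<or>
      (\<lambda>n. measure (M n) {0}) \<longlonglongrightarrow> measure L {0} \<and> (\<lambda>n. h n 0) \<longlonglongrightarrow> h' 0"
  shows "(\<lambda>n. \<integral>z. h n z \<partial>M n) \<longlonglongrightarrow> (\<integral>z. h' z \<partial>L)"
proof -
  have B: "0 \<le> B" using bound(2)[of 0] by linarith
  obtain \<Omega> :: "real measure" and Y :: "nat \<Rightarrow> real \<Rightarrow> real" and Z :: "real \<Rightarrow> real" where
    "prob_space \<Omega>" and Y [measurable]: "\<And>n. Y n \<in> borel_measurable \<Omega>"
    and dY: "\<And>n. distr \<Omega> borel (Y n) = M n" and Z [measurable]: "Z \<in> borel_measurable \<Omega>"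
    and dZ: "distr \<Omega> borel Z = L" and YZ: "\<And>x. x \<in> space \<Omega> \<Longrightarrow> (\<lambda>n. Y n x) \<longlonglongrightarrow> Z x"
    using Skorohod[OF M] by force
  interpret prob_space \<Omega> by fact
  have Y0: "AE x in \<Omega>. \<forall>n. 0 \<le> Y n x"
    unfolding AE_all_countable
  proof
    fix n show "AE x in \<Omega>. 0 \<le> Y n x"
      using nonneg(1)[of n] unfolding dY[symmetric] by (subst (asm) AE_distr_iff) auto
  qed
  have Z0: "AE x in \<Omega>. 0 \<le> Z x"
    using nonneg(2) unfolding dZ[symmetric] by (subst (asm) AE_distr_iff) auto
  have Z_pos: "AE x in \<Omega>. 0 < Z x \<longrightarrow> (\<forall>zs. (\<forall>n. 0 \<le> zs n) \<longrightarrow> zs \<longlonglongrightarrow> Z x \<longrightarrow> (\<lambda>n. h n (zs n)) \<longlonglongrightarrow> h' (Z x))"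
    using pos unfolding dZ[symmetric] by (rule AE_distrD[OF Z])
  have int: "integrable \<Omega> (\<lambda>x. h n (Y n x))" "integrable \<Omega> (\<lambda>x. h' (Z x))" for n
    by (rule integrable_const_bound[of _ B]; use bound in simp)+
  have eq: "(\<integral>z. h n z \<partial>M n) = (\<integral>x. h n (Y n x) \<partial>\<Omega>)" "(\<integral>z. h' z \<partial>L) = (\<integral>x. h' (Z x) \<partial>\<Omega>)" for n
    by (simp_all add: dY[symmetric] dZ[symmetric] integral_distr)
  from zero show ?thesis
  proof
    assume z: "\<forall>zs. (\<forall>n. 0 \<le> zs n) \<longrightarrow> zs \<longlonglongrightarrow> 0 \<longrightarrow> (\<lambda>n. h n (zs n)) \<longlonglongrightarrow> h' 0"
    have "AE x in \<Omega>. (\<lambda>n. h n (Y n x)) \<longlonglongrightarrow> h' (Z x)"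
      using Y0 Z0 Z_pos AE_space
    proof eventually_elim
      case (elim x)
      then show ?case
        using YZ[of x] z by (cases "Z x = 0") auto
    qed
    then show ?thesis
      unfolding eq using bound by (intro integral_dominated_convergence[where w = "\<lambda>_. B"]) auto
  next
    assume z: "(\<lambda>n. measure (M n) {0}) \<longlonglongrightarrow> measure L {0} \<and> (\<lambda>n. h n 0) \<longlonglongrightarrow> h' 0"
    \<comment> \<open>\<open>D n\<close> is the difference of the two integrands with the
      uncontrolled event Z = 0, Y n \<noteq> 0 cut out; \<open>N n\<close> is the probability of
      that event.\<close>
    define D where "D n x = (if Z x = 0 then if Y n x = 0 then h n 0 - h' 0 else 0 else h n (Y n x) - h' (Z x))" for n x
    define N where "N n = prob {x \<in> space \<Omega>. Z x = 0 \<and> Y n x \<noteq> 0}" for n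
    have D [measurable]: "D n \<in> borel_measurable \<Omega>" for n unfolding D_def by measurable
    have D_bound: "\<bar>D n x\<bar> \<le> 2 * B" for n x
      using bound(1)[of n "Y n x"] bound(1)[of n 0] bound(2)[of "Z x"] bound(2)[of 0]
      unfolding D_def by auto
    have "AE x in \<Omega>. (\<lambda>n. D n x) \<longlonglongrightarrow> 0"
      using Y0 Z0 Z_pos AE_space
    proof eventually_elim
      case (elim x)
      show ?case
      proof (cases "Z x = 0")
        case True
        from z have lim: "(\<lambda>n. h n 0 - h' 0) \<longlonglongrightarrow> 0" by (simp add: LIM_zero_iff)
        show ?thesis
          by (rule Lim_null_comparison[OF _ tendsto_norm_zero[OF lim]]) (simp add: D_def True)
      next
        case False
        with elim have "(\<lambda>n. h n (Y n x)) \<longlonglongrightarrow> h' (Z x)"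
          using YZ[of x] by auto
        then show ?thesis using False by (simp add: D_def LIM_zero_iff)
      qed
    qed
    then have D_lim: "(\<lambda>n. \<integral>x. D n x \<partial>\<Omega>) \<longlonglongrightarrow> (\<integral>x. 0 \<partial>\<Omega>)"
      using D_bound by (intro integral_dominated_convergence[where w = "\<lambda>_. 2 * B"]) auto
    \<comment> \<open>Where the limit is nonzero the sequence is eventually nonzero, so this event
      dies out.\<close>
    have "(\<lambda>n. \<integral>x. indicator {x \<in> space \<Omega>. Z x \<noteq> 0 \<and> Y n x = 0} x \<partial>\<Omega>) \<longlonglongrightarrow> (\<integral>x. (0::real) \<partial>\<Omega>)"
    proof (intro integral_dominated_convergence[where w = "\<lambda>_. 1"] AE_I2)
      fix x assume x: "x \<in> space \<Omega>"
      show "(\<lambda>n. indicator {x \<in> space \<Omega>. Z x \<noteq> 0 \<and> Y n x = 0} x :: real) \<longlonglongrightarrow> 0"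
      proof (cases "Z x = 0")
        case False
        have "\<forall>\<^sub>F n in sequentially. Y n x \<noteq> 0"
          using tendsto_imp_eventually_ne[OF YZ[OF x] False] .
        then show ?thesis by (intro tendsto_eventually) (auto elim: eventually_mono)
      qed simp
    qed auto
    then have a: "(\<lambda>n. prob {x \<in> space \<Omega>. Z x \<noteq> 0 \<and> Y n x = 0}) \<longlonglongrightarrow> 0" by simp
    \<comment> \<open>Both atoms split along the common event Z = 0 = Y n, which cancels in the
      difference.\<close>
    have "N n = measure L {0} - measure (M n) {0} + prob {x \<in> space \<Omega>. Z x \<noteq> 0 \<and> Y n x = 0}" for n
    proof -
      have "measure L {0} = prob {x \<in> space \<Omega>. Z x = 0}"
        unfolding dZ[symmetric] by (subst measure_distr) (auto intro!: arg_cong[where f = prob])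
      also have "{x \<in> space \<Omega>. Z x = 0} = {x \<in> space \<Omega>. Z x = 0 \<and> Y n x \<noteq> 0} \<union> {x \<in> space \<Omega>. Z x = 0 \<and> Y n x = 0}"
        by auto
      also have "prob \<dots> = N n + prob {x \<in> space \<Omega>. Z x = 0 \<and> Y n x = 0}"
        unfolding N_def by (rule finite_measure_Union) auto
      finally have L: "measure L {0} = \<dots>" .
      have "measure (M n) {0} = prob {x \<in> space \<Omega>. Y n x = 0}"
        unfolding dY[symmetric] by (subst measure_distr) (auto intro!: arg_cong[where f = prob])
      also have "{x \<in> space \<Omega>. Y n x = 0} = {x \<in> space \<Omega>. Z x \<noteq> 0 \<and> Y n x = 0} \<union> {x \<in> space \<Omega>. Z x = 0 \<and> Y n x = 0}"
        by auto
      also have "prob \<dots> = prob {x \<in> space \<Omega>. Z x \<noteq> 0 \<and> Y n x = 0} + prob {x \<in> space \<Omega>. Z x = 0 \<and> Y n x = 0}"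
        by (rule finite_measure_Union) auto
      finally show ?thesis using L by simp
    qed
    then have N_eq: "N = (\<lambda>n. measure L {0} - measure (M n) {0} + prob {x \<in> space \<Omega>. Z x \<noteq> 0 \<and> Y n x = 0})"
      by (rule ext)
    have N_lim: "N \<longlonglongrightarrow> measure L {0} - measure L {0} + 0"
      unfolding N_eq by (rule tendsto_add[OF tendsto_diff[OF tendsto_const] a]) (use z in simp)
    have le: "\<bar>(\<integral>x. h n (Y n x) \<partial>\<Omega>) - (\<integral>x. h' (Z x) \<partial>\<Omega>)\<bar> \<le> \<bar>\<integral>x. D n x \<partial>\<Omega>\<bar> + 2 * B * N n" for n
    proof -
      let ?E = "{x \<in> space \<Omega>. Z x = 0 \<and> Y n x \<noteq> 0}"
      have intD: "integrable \<Omega> (D n)"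
        by (rule integrable_const_bound[of _ "2 * B"]) (use D_bound in auto)
      have "\<bar>(\<integral>x. h n (Y n x) \<partial>\<Omega>) - (\<integral>x. h' (Z x) \<partial>\<Omega>) - (\<integral>x. D n x \<partial>\<Omega>)\<bar>
          = \<bar>\<integral>x. h n (Y n x) - h' (Z x) - D n x \<partial>\<Omega>\<bar>"
        using int intD by simp
      also have "\<dots> \<le> (\<integral>x. \<bar>h n (Y n x) - h' (Z x) - D n x\<bar> \<partial>\<Omega>)" by (rule integral_abs_bound)
      \<comment> \<open>Off \<open>?E\<close> the integrand vanishes by the choice of
        \<open>D\<close>; on \<open>?E\<close> it is at most 2 B.\<close>
      also have "\<dots> \<le> (\<integral>x. 2 * B * indicator ?E x \<partial>\<Omega>)"
      proof (rule integral_mono)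
        fix x assume "x \<in> space \<Omega>"
        then show "\<bar>h n (Y n x) - h' (Z x) - D n x\<bar> \<le> 2 * B * indicator ?E x"
          using bound(1)[of n "Y n x"] bound(2)[of "Z x"] by (auto simp: D_def)
      next
        show "integrable \<Omega> (\<lambda>x. 2 * B * indicator ?E x)"
          by (rule integrable_const_bound[of _ "2 * B"]) (use B in \<open>auto simp: indicator_def\<close>)
      qed (use int intD in auto)
      also have "\<dots> = 2 * B * N n" unfolding N_def by simp
      finally show ?thesis by linarith
    qed
    have lim: "(\<lambda>n. \<bar>\<integral>x. D n x \<partial>\<Omega>\<bar> + 2 * B * N n) \<longlonglongrightarrow> \<bar>\<integral>x. 0 \<partial>\<Omega>\<bar> + 2 * B * (measure L {0} - measure L {0} + 0)"
      by (rule tendsto_add[OF tendsto_rabs[OF D_lim] tendsto_mult[OF tendsto_const N_lim]])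
    have "(\<lambda>n. (\<integral>x. h n (Y n x) \<partial>\<Omega>) - (\<integral>x. h' (Z x) \<partial>\<Omega>)) \<longlonglongrightarrow> 0"
      by (rule Lim_null_comparison[where g = "\<lambda>n. \<bar>\<integral>x. D n x \<partial>\<Omega>\<bar> + 2 * B * N n"])
         (use le lim in simp_all)
    then show ?thesis unfolding eq by (simp add: LIM_zero_iff)
  qed
qed

section \<open>Path expectations of Markov chains\<close>

text \<open>The expectation of f 0 (X_1) ... f (n-1) (X_n) for a chain with kernel \<open>K\<close>
  started at \<open>x\<close>, unfolded at the first step. The test function with index i belongs to
  time i + 1.\<close>

primrec path_expectation :: "('a \<Rightarrow> 'a measure) \<Rightarrow> nat \<Rightarrow> (nat \<Rightarrow> 'a \<Rightarrow> real) \<Rightarrow> 'a \<Rightarrow> real" where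
  "path_expectation K 0 f x = 1"
| "path_expectation K (Suc n) f x =
     (\<integral>z. f 0 z * path_expectation K n (\<lambda>i. f (Suc i)) z \<partial>K x)"

lemma path_expectation_0: "path_expectation K 0 f = (\<lambda>_. 1)"
  by (rule ext) simp

lemma path_expectation_Suc:
  "path_expectation K (Suc n) f = (\<lambda>x. \<integral>z. f 0 z * path_expectation K n (\<lambda>i. f (Suc i)) z \<partial>K x)"
  by (rule ext) simp

lemma measurable_kernel_integral:
  fixes g :: "'a \<Rightarrow> real"
  assumes "K \<in> S \<rightarrow>\<^sub>M prob_algebra S" "g \<in> borel_measurable S"
  shows "(\<lambda>x. \<integral>z. g z \<partial>K x) \<in> borel_measurable S"
  using measurable_compose[OF measurable_prob_algebraD[OF assms(1)] integral_measurable_subprob_algebra[OF assms(2)]] .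

lemma prob_space_kernel:
  assumes "K \<in> S \<rightarrow>\<^sub>M prob_algebra S" "x \<in> space S"
  shows "prob_space (K x)" "sets (K x) = sets S"
  using measurable_space[OF assms] by (auto simp: space_prob_algebra)

lemma measurable_path_expectation:
  assumes "K \<in> S \<rightarrow>\<^sub>M prob_algebra S" "\<And>i. f i \<in> borel_measurable S"
  shows "path_expectation K n f \<in> borel_measurable S"
  using assms(2)
proof (induction n arbitrary: f)
  case (Suc n)
  then have [measurable]: "path_expectation K n (\<lambda>i. f (Suc i)) \<in> borel_measurable S" "f 0 \<in> borel_measurable S"
    by auto
  show ?case
    by (simp add: path_expectation_Suc measurable_kernel_integral[OF assms(1)])
qed (simp add: path_expectation_0)

text \<open>\<open>A\<close> is a set that the kernel does not leave. This generality is needed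
  since a kernel on the half-line is known to consist of probability measures only at nonnegative
  states.\<close>

lemma path_expectation_range:
  assumes K: "\<And>x. x \<in> A \<Longrightarrow> prob_space (K x) \<and> space (K x) \<subseteq> A" and f: "\<And>i z. z \<in> A \<Longrightarrow> f i z \<in> {0..1}"
    and "x \<in> A"
  shows "path_expectation K n f x \<in> {0..1}"
  using f \<open>x \<in> A\<close>
proof (induction n arbitrary: f x)
  case (Suc n)
  interpret prob_space "K x" using K Suc by auto
  have *: "z \<in> space (K x) \<Longrightarrow> path_expectation K n (\<lambda>i. f (Suc i)) z \<in> {0..1} \<and> f 0 z \<in> {0..1}" for z
    using Suc.IH[of "\<lambda>i. f (Suc i)" z] Suc.prems K[of x] by auto
  have "(\<integral>z. f 0 z * path_expectation K n (\<lambda>i. f (Suc i)) z \<partial>K x) \<le> (\<integral>z. 1 \<partial>K x)"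
    using * by (intro integral_mono') (auto intro: mult_le_one)
  moreover have "0 \<le> (\<integral>z. f 0 z * path_expectation K n (\<lambda>i. f (Suc i)) z \<partial>K x)"
    using * by (intro Bochner_Integration.integral_nonneg) auto
  ultimately show ?case by (simp add: prob_space)
qed simp

section \<open>From the Markov property as a conditional expectation to path expectations\<close>

abbreviation past_algebra :: "'w measure \<Rightarrow> 'a measure \<Rightarrow> (nat \<Rightarrow> 'w \<Rightarrow> 'a) \<Rightarrow> nat \<Rightarrow> 'w measure" where
  "past_algebra M S X n \<equiv>
     vimage_algebra (space M) (\<lambda>\<omega>. \<lambda>i\<in>{..n}. X i \<omega>) (\<Pi>\<^sub>M i\<in>{..n}. S)"

context
  fixes M :: "'w measure" and S :: "'a measure" and K X
  assumes chain: "markov_chain M S K X" and K: "K \<in> S \<rightarrow>\<^sub>M prob_algebra S"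
begin

lemma prob_space_chain: "prob_space M"
  using chain by (simp add: markov_chain_def)

lemma measurable_chain: "X n \<in> M \<rightarrow>\<^sub>M S"
  using chain by (simp add: markov_chain_def)

lemma subalgebra_past: "subalgebra M (past_algebra M S X n)"
proof -
  have "sets (past_algebra M S X n) \<subseteq> sets M"
    by (rule sets_image_in_sets) (auto intro: measurable_restrict measurable_chain)
  then show ?thesis by (simp add: subalgebra_def)
qed

lemma measurable_past_X: "i \<le> n \<Longrightarrow> X i \<in> past_algebra M S X n \<rightarrow>\<^sub>M S"
proof -
  assume "i \<le> n"
  have "(\<lambda>\<omega>. \<lambda>i\<in>{..n}. X i \<omega>) \<in> past_algebra M S X n \<rightarrow>\<^sub>M (\<Pi>\<^sub>M i\<in>{..n}. S)"
    by (rule measurable_vimage_algebra1) (auto simp: space_PiM intro: measurable_space[OF measurable_chain] split: if_splits)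
  from measurable_compose[OF this measurable_component_singleton[of i]] \<open>i \<le> n\<close> show ?thesis by simp
qed

lemma past_mono: "n \<le> k \<Longrightarrow> h \<in> borel_measurable (past_algebra M S X n) \<Longrightarrow> h \<in> borel_measurable (past_algebra M S X k)"
proof (rule measurable_from_subalg[rotated])
  assume "n \<le> k"
  then have "sets (past_algebra M S X n) \<subseteq> sets (past_algebra M S X k)"
    by (intro sets_image_in_sets measurable_restrict measurable_past_X) auto
  then show "subalgebra (past_algebra M S X k) (past_algebra M S X n)"
    by (simp add: subalgebra_def)
qed

text \<open>For indicators this is the Markov property combined with the defining property of
  conditional expectation, \<open>h\<close> being a weight that depends on the past only. Sums,
  multiples and increasing limits extend it to nonnegative measurable functions, whence the extended
  nonnegative integrals.\<close>

lemma markov_chain_nn_step: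
  fixes h :: "'w \<Rightarrow> real" and f :: "'a \<Rightarrow> ennreal"
  assumes h: "h \<in> borel_measurable (past_algebra M S X n)" "\<And>\<omega>. h \<omega> \<in> {0..1}"
    and f: "f \<in> borel_measurable S"
  shows "(\<integral>\<^sup>+\<omega>. h \<omega> * f (X (Suc n) \<omega>) \<partial>M) = (\<integral>\<^sup>+\<omega>. h \<omega> * (\<integral>\<^sup>+z. f z \<partial>K (X n \<omega>)) \<partial>M)"
proof -
  interpret prob_space M by (rule prob_space_chain)
  note [measurable] = measurable_chain
  interpret sub: finite_measure_subalgebra M "past_algebra M S X n"
    by unfold_locales (rule subalgebra_past)
  have h_M [measurable]: "h \<in> borel_measurable M"
    by (rule measurable_from_subalg[OF subalgebra_past h(1)])
  have h01: "0 \<le> h \<omega>" "h \<omega> \<le> 1" for \<omega> using h(2)[of \<omega>] by auto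
  have Kx: "prob_space (K (X n \<omega>))" "sets (K (X n \<omega>)) = sets S" if "\<omega> \<in> space M" for \<omega>
    using prob_space_kernel[OF K measurable_space[OF measurable_chain that]] by auto
  have KM [measurable]: "(\<lambda>\<omega>. K (X n \<omega>)) \<in> M \<rightarrow>\<^sub>M subprob_algebra S"
    by (rule measurable_compose[OF measurable_chain measurable_prob_algebraD[OF K]])
  show ?thesis
    using f
  proof (induction f rule: borel_measurable_induct)
    case (cong f g)
    have "(\<integral>\<^sup>+z. f z \<partial>K (X n \<omega>)) = (\<integral>\<^sup>+z. g z \<partial>K (X n \<omega>))" if "\<omega> \<in> space M" for \<omega>
      using cong(3) sets_eq_imp_space_eq[OF Kx(2)[OF that]] by (intro nn_integral_cong) auto
    moreover have "f (X (Suc n) \<omega>) = g (X (Suc n) \<omega>)" if "\<omega> \<in> space M" for \<omega>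
      using cong(3) measurable_space[OF measurable_chain that] by auto
    ultimately show ?case using cong(4) by (simp cong: nn_integral_cong)
  next
    case (set A)
    then have [measurable]: "A \<in> sets S" by simp
    let ?I = "\<lambda>\<omega>. indicator A (X (Suc n) \<omega>) :: real"
    have int: "integrable M (\<lambda>\<omega>. h \<omega> * ?I \<omega>)"
      by (rule integrable_const_bound[of _ 1]) (auto simp: indicator_def h01)
    have [measurable]: "(\<lambda>\<omega>. measure (K (X n \<omega>)) A) \<in> borel_measurable M"
      by (rule measurable_compose[OF KM measurable_measure_subprob_algebra]) simp
    have K01: "0 \<le> h \<omega> * measure (K (X n \<omega>)) A" "h \<omega> * measure (K (X n \<omega>)) A \<le> 1" if "\<omega> \<in> space M" for \<omega>
      using h01 prob_space.prob_le_1[OF Kx(1)[OF that]] by (auto intro: mult_le_one)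
    have "(\<integral>\<omega>. h \<omega> * measure (K (X n \<omega>)) A \<partial>M)
        = (\<integral>\<omega>. h \<omega> * real_cond_exp M (past_algebra M S X n) ?I \<omega> \<partial>M)"
    proof (rule integral_cong_AE)
      have "AE \<omega> in M. real_cond_exp M (past_algebra M S X n) ?I \<omega> = measure (K (X n \<omega>)) A"
        using chain \<open>A \<in> sets S\<close> unfolding markov_chain_def by auto
      then show "AE \<omega> in M. h \<omega> * measure (K (X n \<omega>)) A = h \<omega> * real_cond_exp M (past_algebra M S X n) ?I \<omega>"
        by eventually_elim simp
    qed auto
    also have "\<dots> = (\<integral>\<omega>. h \<omega> * ?I \<omega> \<partial>M)"
      by (rule sub.real_cond_exp_intg(2)[OF int h(1)]) measurable
    finally have eq: "(\<integral>\<omega>. h \<omega> * measure (K (X n \<omega>)) A \<partial>M) = (\<integral>\<omega>. h \<omega> * ?I \<omega> \<partial>M)" .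
    have "(\<integral>\<^sup>+\<omega>. ennreal (h \<omega>) * indicator A (X (Suc n) \<omega>) \<partial>M) = (\<integral>\<^sup>+\<omega>. ennreal (h \<omega> * ?I \<omega>) \<partial>M)"
      by (intro nn_integral_cong) (auto simp: indicator_def)
    moreover have "(\<integral>\<^sup>+\<omega>. ennreal (h \<omega> * ?I \<omega>) \<partial>M) = ennreal (\<integral>\<omega>. h \<omega> * ?I \<omega> \<partial>M)"
      by (rule nn_integral_eq_integral[OF int]) (auto simp: h01)
    moreover have "ennreal (\<integral>\<omega>. h \<omega> * ?I \<omega> \<partial>M) = (\<integral>\<^sup>+\<omega>. ennreal (h \<omega> * measure (K (X n \<omega>)) A) \<partial>M)"
      unfolding eq[symmetric] using K01
      by (intro nn_integral_eq_integral[symmetric] integrable_const_bound[of _ 1]) auto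
    moreover have "(\<integral>\<^sup>+\<omega>. ennreal (h \<omega> * measure (K (X n \<omega>)) A) \<partial>M) = (\<integral>\<^sup>+\<omega>. h \<omega> * (\<integral>\<^sup>+z. indicator A z \<partial>K (X n \<omega>)) \<partial>M)"
    proof (rule nn_integral_cong)
      fix \<omega> assume "\<omega> \<in> space M"
      then interpret k: prob_space "K (X n \<omega>)" by (rule Kx)
      show "ennreal (h \<omega> * measure (K (X n \<omega>)) A) = ennreal (h \<omega>) * (\<integral>\<^sup>+z. indicator A z \<partial>K (X n \<omega>))"
        using Kx(2)[OF \<open>\<omega> \<in> space M\<close>] h01 by (simp add: ennreal_mult k.emeasure_eq_measure)
    qed
    ultimately show ?case by simp
  next
    case (mult u c)
    have "(\<integral>\<^sup>+\<omega>. h \<omega> * (c * u (X (Suc n) \<omega>)) \<partial>M) = c * (\<integral>\<^sup>+\<omega>. h \<omega> * u (X (Suc n) \<omega>) \<partial>M)"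
      using mult(2) by (subst nn_integral_cmult[symmetric]) (auto simp: mult_ac)
    also have "\<dots> = (\<integral>\<^sup>+\<omega>. c * (h \<omega> * (\<integral>\<^sup>+z. u z \<partial>K (X n \<omega>))) \<partial>M)"
      unfolding mult using mult(2) by (subst nn_integral_cmult) auto
    also have "\<dots> = (\<integral>\<^sup>+\<omega>. h \<omega> * (\<integral>\<^sup>+z. c * u z \<partial>K (X n \<omega>)) \<partial>M)"
      using mult(2) Kx by (intro nn_integral_cong, subst nn_integral_cmult) (auto simp: mult_ac cong: measurable_cong_sets)
    finally show ?case .
  next
    case (add u v)
    note [measurable] = add.hyps(1,3)
    have "(\<integral>\<^sup>+\<omega>. h \<omega> * (u (X (Suc n) \<omega>) + v (X (Suc n) \<omega>)) \<partial>M)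
        = (\<integral>\<^sup>+\<omega>. h \<omega> * u (X (Suc n) \<omega>) \<partial>M) + (\<integral>\<^sup>+\<omega>. h \<omega> * v (X (Suc n) \<omega>) \<partial>M)"
      by (subst nn_integral_add[symmetric]) (auto simp: distrib_left)
    also have "\<dots> = (\<integral>\<^sup>+\<omega>. h \<omega> * (\<integral>\<^sup>+z. u z \<partial>K (X n \<omega>)) + h \<omega> * (\<integral>\<^sup>+z. v z \<partial>K (X n \<omega>)) \<partial>M)"
      unfolding add.IH by (subst nn_integral_add) auto
    also have "\<dots> = (\<integral>\<^sup>+\<omega>. h \<omega> * (\<integral>\<^sup>+z. u z + v z \<partial>K (X n \<omega>)) \<partial>M)"
      using add.hyps(1,3) Kx by (intro nn_integral_cong, subst nn_integral_add) (auto simp: distrib_left cong: measurable_cong_sets)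
    finally show ?case by (simp add: ac_simps)
  next
    case (seq U)
    note [measurable] = seq(1)
    have Suc_mono: "incseq (\<lambda>i. c * U i z)" for c z
      using seq(3) by (auto simp: incseq_def le_fun_def intro: mult_left_mono)
    have "(\<integral>\<^sup>+\<omega>. h \<omega> * (SUP i. U i) (X (Suc n) \<omega>) \<partial>M) = (\<integral>\<^sup>+\<omega>. (SUP i. h \<omega> * U i (X (Suc n) \<omega>)) \<partial>M)"
      by (simp add: SUP_mult_left_ennreal image_comp)
    also have "\<dots> = (SUP i. \<integral>\<^sup>+\<omega>. h \<omega> * U i (X (Suc n) \<omega>) \<partial>M)"
      using Suc_mono by (intro nn_integral_monotone_convergence_SUP) (auto simp: incseq_def le_fun_def)
    also have "\<dots> = (SUP i. \<integral>\<^sup>+\<omega>. h \<omega> * (\<integral>\<^sup>+z. U i z \<partial>K (X n \<omega>)) \<partial>M)"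
      using seq by simp
    also have "\<dots> = (\<integral>\<^sup>+\<omega>. (SUP i. h \<omega> * (\<integral>\<^sup>+z. U i z \<partial>K (X n \<omega>))) \<partial>M)"
      using seq(3)
      by (intro nn_integral_monotone_convergence_SUP[symmetric])
         (auto simp: incseq_def le_fun_def intro!: mult_left_mono nn_integral_mono)
    also have "\<dots> = (\<integral>\<^sup>+\<omega>. h \<omega> * (\<integral>\<^sup>+z. (SUP i. U i) z \<partial>K (X n \<omega>)) \<partial>M)"
    proof (rule nn_integral_cong)
      fix \<omega> assume "\<omega> \<in> space M"
      then have "(\<integral>\<^sup>+z. (SUP i. U i z) \<partial>K (X n \<omega>)) = (SUP i. \<integral>\<^sup>+z. U i z \<partial>K (X n \<omega>))"
        using seq Kx by (intro nn_integral_monotone_convergence_SUP) (auto cong: measurable_cong_sets)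
      then show "(SUP i. h \<omega> * (\<integral>\<^sup>+z. U i z \<partial>K (X n \<omega>))) = h \<omega> * (\<integral>\<^sup>+z. (SUP i. U i) z \<partial>K (X n \<omega>))"
        by (simp add: SUP_mult_left_ennreal image_comp)
    qed
    finally show ?case .
  qed
qed

text \<open>The bounded case, read off from the version for nonnegative functions. The bound is
  required on the state space only, which is where the range of a path expectation is known.\<close>

lemma markov_chain_step:
  fixes h :: "'w \<Rightarrow> real" and f :: "'a \<Rightarrow> real"
  assumes h: "h \<in> borel_measurable (past_algebra M S X n)" "\<And>\<omega>. h \<omega> \<in> {0..1}"
    and f [measurable]: "f \<in> borel_measurable S" and f01: "\<And>z. z \<in> space S \<Longrightarrow> f z \<in> {0..1}"
  shows "(\<integral>\<omega>. h \<omega> * f (X (Suc n) \<omega>) \<partial>M) = (\<integral>\<omega>. h \<omega> * (\<integral>z. f z \<partial>K (X n \<omega>)) \<partial>M)"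
proof -
  interpret prob_space M by (rule prob_space_chain)
  note [measurable] = measurable_chain
  have [measurable]: "h \<in> borel_measurable M"
    by (rule measurable_from_subalg[OF subalgebra_past h(1)])
  have h01: "0 \<le> h \<omega>" "h \<omega> \<le> 1" for \<omega> using h(2)[of \<omega>] by auto
  have [measurable]: "(\<lambda>x. \<integral>z. f z \<partial>K x) \<in> borel_measurable S"
    by (rule measurable_kernel_integral[OF K f])
  have fX: "0 \<le> f (X k \<omega>)" if "\<omega> \<in> space M" for k \<omega>
    using f01[OF measurable_space[OF measurable_chain that]] by auto
  have Kf: "0 \<le> (\<integral>z. f z \<partial>K (X n \<omega>))" "(\<integral>\<^sup>+z. ennreal (f z) \<partial>K (X n \<omega>)) = ennreal (\<integral>z. f z \<partial>K (X n \<omega>))"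
    if "\<omega> \<in> space M" for \<omega>
  proof -
    note Kx = prob_space_kernel[OF K measurable_space[OF measurable_chain that], of n]
    interpret k: prob_space "K (X n \<omega>)" by (rule Kx)
    note [measurable_cong] = Kx(2)
    have sp: "space (K (X n \<omega>)) = space S" by (rule sets_eq_imp_space_eq[OF Kx(2)])
    show "0 \<le> (\<integral>z. f z \<partial>K (X n \<omega>))"
      using f01 sp by (intro Bochner_Integration.integral_nonneg) auto
    show "(\<integral>\<^sup>+z. ennreal (f z) \<partial>K (X n \<omega>)) = ennreal (\<integral>z. f z \<partial>K (X n \<omega>))"
      using f01 sp by (intro nn_integral_eq_integral k.integrable_const_bound[of _ 1]) auto
  qed
  have "(\<integral>\<omega>. h \<omega> * f (X (Suc n) \<omega>) \<partial>M) = enn2real (\<integral>\<^sup>+\<omega>. ennreal (h \<omega> * f (X (Suc n) \<omega>)) \<partial>M)"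
    using fX h01 by (intro integral_eq_nn_integral) auto
  also have "(\<integral>\<^sup>+\<omega>. ennreal (h \<omega> * f (X (Suc n) \<omega>)) \<partial>M) = (\<integral>\<^sup>+\<omega>. h \<omega> * ennreal (f (X (Suc n) \<omega>)) \<partial>M)"
    using fX h01 by (intro nn_integral_cong) (auto simp: ennreal_mult)
  also have "\<dots> = (\<integral>\<^sup>+\<omega>. h \<omega> * (\<integral>\<^sup>+z. ennreal (f z) \<partial>K (X n \<omega>)) \<partial>M)"
    by (rule markov_chain_nn_step[OF h]) measurable
  also have "\<dots> = (\<integral>\<^sup>+\<omega>. ennreal (h \<omega> * (\<integral>z. f z \<partial>K (X n \<omega>))) \<partial>M)"
    using Kf h01 by (intro nn_integral_cong) (auto simp: ennreal_mult)
  also have "enn2real \<dots> = (\<integral>\<omega>. h \<omega> * (\<integral>z. f z \<partial>K (X n \<omega>)) \<partial>M)"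
    using Kf h01 by (intro integral_eq_nn_integral[symmetric]) auto
  finally show ?thesis .
qed

text \<open>The factor at time n + 1 belongs to the past of time n + 1 and is absorbed into the
  weight; the induction hypothesis handles the later factors, and one step of the chain brings the
  result back to time n. Hence \<open>h\<close> and \<open>n\<close> vary in the induction, although
  the final use is with weight 1 at time 0.\<close>

lemma markov_chain_path_expectation:
  fixes h :: "'w \<Rightarrow> real" and f :: "nat \<Rightarrow> 'a \<Rightarrow> real"
  assumes "h \<in> borel_measurable (past_algebra M S X n)" "\<And>\<omega>. h \<omega> \<in> {0..1}"
    and "\<And>i. f i \<in> borel_measurable S" and "\<And>i z. f i z \<in> {0..1}"
  shows "(\<integral>\<omega>. h \<omega> * (\<Prod>i<k. f i (X (Suc n + i) \<omega>)) \<partial>M) = (\<integral>\<omega>. h \<omega> * path_expectation K k f (X n \<omega>) \<partial>M)"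
  using assms
proof (induction k arbitrary: n h f)
  case (Suc k)
  let ?g = "path_expectation K k (\<lambda>i. f (Suc i))"
  have Kx: "x \<in> space S \<Longrightarrow> prob_space (K x) \<and> space (K x) \<subseteq> space S" for x
    using prob_space_kernel[OF K, of x] sets_eq_imp_space_eq[of "K x" S] by auto
  have g01: "?g z \<in> {0..1}" if "z \<in> space S" for z
    by (rule path_expectation_range[of "space S"]) (use Kx Suc.prems that in auto)
  note [measurable] = measurable_chain Suc.prems(3) measurable_path_expectation[OF K, of "\<lambda>i. f (Suc i)" k, OF Suc.prems(3)]
  have "(\<integral>\<omega>. h \<omega> * (\<Prod>i<Suc k. f i (X (Suc n + i) \<omega>)) \<partial>M)
      = (\<integral>\<omega>. (h \<omega> * f 0 (X (Suc n) \<omega>)) * (\<Prod>i<k. f (Suc i) (X (Suc (Suc n) + i) \<omega>)) \<partial>M)"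
    by (simp add: prod.lessThan_Suc_shift mult.assoc del: prod.lessThan_Suc)
  also have "\<dots> = (\<integral>\<omega>. (h \<omega> * f 0 (X (Suc n) \<omega>)) * ?g (X (Suc n) \<omega>) \<partial>M)"
  proof (rule Suc.IH)
    show "(\<lambda>\<omega>. h \<omega> * f 0 (X (Suc n) \<omega>)) \<in> borel_measurable (past_algebra M S X (Suc n))"
      by (intro borel_measurable_times past_mono[OF _ Suc.prems(1)]
          measurable_compose[OF measurable_past_X Suc.prems(3)]) auto
    show "h \<omega> * f 0 (X (Suc n) \<omega>) \<in> {0..1}" for \<omega>
      using Suc.prems(2)[of \<omega>] Suc.prems(4)[of 0 "X (Suc n) \<omega>"] by (auto intro: mult_le_one)
  qed (use Suc.prems in auto)
  also have "\<dots> = (\<integral>\<omega>. h \<omega> * (\<lambda>z. f 0 z * ?g z) (X (Suc n) \<omega>) \<partial>M)"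
    by (simp add: mult.assoc)
  also have "\<dots> = (\<integral>\<omega>. h \<omega> * (\<integral>z. f 0 z * ?g z \<partial>K (X n \<omega>)) \<partial>M)"
    by (rule markov_chain_step[OF Suc.prems(1,2)])
       (use g01 Suc.prems(4) in \<open>auto intro: mult_le_one\<close>)
  finally show ?case by simp
qed simp

end

section \<open>Path expectations of the tail chain\<close>

text \<open>The transition kernel of the tail chain: the next state is the present one times an
  independent variable with law \<open>G\<close>.\<close>

definition scaling_kernel :: "real measure \<Rightarrow> real \<Rightarrow> real measure" where
  "scaling_kernel G x = distr G borel (\<lambda>z. x * z)"

lemma scaling_kernel_measurable:
  assumes "prob_space G" "sets G = sets borel"
  shows "scaling_kernel G \<in> borel \<rightarrow>\<^sub>M prob_algebra borel"
proof -
  have [measurable]: "(\<lambda>_. G) \<in> borel \<rightarrow>\<^sub>M prob_algebra borel"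
    by (rule measurable_const) (use assms in \<open>simp add: space_prob_algebra\<close>)
  have "(\<lambda>x. distr G borel (\<lambda>z. x * z)) \<in> (borel :: real measure) \<rightarrow>\<^sub>M prob_algebra borel"
    by (rule measurable_distr_prob_space2[where M = borel]) measurable
  then show ?thesis by (simp add: scaling_kernel_def[abs_def])
qed

lemma measurable_prod_partial_products:
  fixes f :: "nat \<Rightarrow> real \<Rightarrow> real"
  assumes G: "sets G = sets borel" and f: "\<And>i. f i \<in> borel_measurable borel"
    and A: "\<And>i. i < n \<Longrightarrow> A i \<subseteq> I"
  shows "(\<lambda>x. \<Prod>i<n. f i (s * (\<Prod>j\<in>A i. x j))) \<in> borel_measurable (PiM I (\<lambda>_. G))"
proof (rule borel_measurable_prod)
  fix i assume "i \<in> {..<n}"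
  have "(\<lambda>x. x j) \<in> borel_measurable (PiM I (\<lambda>_. G))" if "j \<in> A i" for j
    using measurable_component_singleton[of j I "\<lambda>_. G"] A \<open>i \<in> {..<n}\<close> that
    by (auto simp: measurable_cong_sets[OF refl G])
  then have "(\<lambda>x. s * (\<Prod>j\<in>A i. x j)) \<in> borel_measurable (PiM I (\<lambda>_. G))"
    by (intro borel_measurable_times borel_measurable_const borel_measurable_prod)
  from measurable_compose[OF this f]
  show "(\<lambda>x. f i (s * (\<Prod>j\<in>A i. x j))) \<in> borel_measurable (PiM I (\<lambda>_. G))" .
qed

text \<open>Fubini with the lowest coordinate outermost: its value z turns the starting state s into
  s z and leaves an integral of the same form over the other coordinates. The offset
  \<open>k\<close> spares a relabelling of these coordinates. The interval
  \<open>{k<..k + Suc i}\<close> has i + 1 elements, one factor per step up to time i + 1.\<close>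

lemma path_expectation_scaling_kernel:
  fixes f :: "nat \<Rightarrow> real \<Rightarrow> real"
  assumes G: "prob_space G" "sets G = sets borel"
    and "\<And>i. f i \<in> borel_measurable borel" and "\<And>i z. f i z \<in> {0..1}"
  shows "(\<integral>\<^sup>+x. ennreal (\<Prod>i<n. f i (s * (\<Prod>j\<in>{k<..k + Suc i}. x j))) \<partial>PiM {k<..k + n} (\<lambda>_. G))
       = ennreal (path_expectation (scaling_kernel G) n f s)"
  using assms(3,4)
proof (induction n arbitrary: f s k)
  case 0
  interpret product_prob_space "\<lambda>_. G" "{}" using G(1)
    by (simp add: product_prob_space_def product_prob_space_axioms_def product_sigma_finite_def prob_space_imp_sigma_finite)
  show ?case using prob_space.emeasure_space_1[OF prob_space_PiM[of "{}" "\<lambda>_. G"]] by simp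
next
  case (Suc n)
  interpret G: prob_space G by fact
  interpret product_prob_space "\<lambda>_. G" UNIV using G(1)
    by (simp add: product_prob_space_def product_prob_space_axioms_def product_sigma_finite_def prob_space_imp_sigma_finite)
  note [measurable_cong] = G(2)
  note [measurable] = Suc.prems(1)
  let ?I = "{Suc k<..Suc k + n}"
  let ?g = "path_expectation (scaling_kernel G) n (\<lambda>i. f (Suc i))"
  let ?F = "\<lambda>x. \<Prod>i<Suc n. f i (s * (\<Prod>j\<in>{k<..k + Suc i}. x j))"
  have f01: "0 \<le> f i z" "f i z \<le> 1" for i z using Suc.prems(2)[of i z] by auto
  have g01: "?g z \<in> {0..1}" for z
    by (rule path_expectation_range[of UNIV])
       (use prob_space_kernel[OF scaling_kernel_measurable[OF G]] Suc.prems in auto)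
  have g_meas [measurable]: "?g \<in> borel_measurable borel"
    by (rule measurable_path_expectation[OF scaling_kernel_measurable[OF G]]) measurable
  have I: "{k<..k + Suc n} = insert (Suc k) ?I" by auto
  have F_upd: "?F (x(Suc k := z)) = f 0 (s * z) * (\<Prod>i<n. f (Suc i) (s * z * (\<Prod>j\<in>{Suc k<..Suc k + Suc i}. x j)))" for x z
  proof -
    have 1: "(\<Prod>j\<in>{k<..k + Suc (Suc i)}. (x(Suc k := z)) j) = z * (\<Prod>j\<in>{Suc k<..Suc k + Suc i}. x j)" for i
    proof -
      have "{k<..k + Suc (Suc i)} = insert (Suc k) {Suc k<..Suc k + Suc i}" by auto
      moreover have "(\<Prod>j\<in>{Suc k<..Suc k + Suc i}. (x(Suc k := z)) j) = (\<Prod>j\<in>{Suc k<..Suc k + Suc i}. x j)"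
        by (intro prod.cong) auto
      ultimately show ?thesis by simp
    qed
    have 2: "(\<Prod>j\<in>{k<..k + Suc 0}. (x(Suc k := z)) j) = z"
    proof -
      have "{k<..k + Suc 0} = {Suc k}" by auto
      then show ?thesis by simp
    qed
    show ?thesis
      unfolding prod.lessThan_Suc_shift comp_def 1 2 by (simp add: mult.assoc)
  qed
  have F_meas: "?F \<in> borel_measurable (PiM {k<..k + Suc n} (\<lambda>_. G))"
    by (rule measurable_prod_partial_products[OF G(2) Suc.prems(1)]) auto
  have "(\<integral>\<^sup>+x. ennreal (?F x) \<partial>PiM {k<..k + Suc n} (\<lambda>_. G))
      = (\<integral>\<^sup>+z. \<integral>\<^sup>+x. ennreal (?F (x(Suc k := z))) \<partial>PiM ?I (\<lambda>_. G) \<partial>G)"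
    unfolding I
    by (rule product_nn_integral_insert_rev[OF _ _ measurable_compose[OF F_meas[unfolded I] measurable_ennreal]]) simp_all
  also have "\<dots> = (\<integral>\<^sup>+z. ennreal (f 0 (s * z)) * ennreal (?g (s * z)) \<partial>G)"
  proof (rule nn_integral_cong)
    fix z
    have P_meas: "(\<lambda>x. \<Prod>i<n. f (Suc i) (s * z * (\<Prod>j\<in>{Suc k<..Suc k + Suc i}. x j))) \<in> borel_measurable (PiM ?I (\<lambda>_. G))"
      by (rule measurable_prod_partial_products[OF G(2) Suc.prems(1)]) auto
    have "(\<integral>\<^sup>+x. ennreal (?F (x(Suc k := z))) \<partial>PiM ?I (\<lambda>_. G))
        = (\<integral>\<^sup>+x. ennreal (f 0 (s * z)) * ennreal (\<Prod>i<n. f (Suc i) (s * z * (\<Prod>j\<in>{Suc k<..Suc k + Suc i}. x j))) \<partial>PiM ?I (\<lambda>_. G))"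
      unfolding F_upd using f01 by (intro nn_integral_cong) (simp add: ennreal_mult prod_nonneg)
    also have "\<dots> = ennreal (f 0 (s * z)) * ennreal (?g (s * z))"
      unfolding Suc.IH[where f = "\<lambda>i. f (Suc i)" and s = "s * z" and k = "Suc k", OF Suc.prems, symmetric]
      by (rule nn_integral_cmult[OF measurable_compose[OF P_meas measurable_ennreal]])
    finally show "(\<integral>\<^sup>+x. ennreal (?F (x(Suc k := z))) \<partial>PiM ?I (\<lambda>_. G)) = ennreal (f 0 (s * z)) * ennreal (?g (s * z))" .
  qed
  also have "\<dots> = (\<integral>\<^sup>+z. ennreal (f 0 (s * z) * ?g (s * z)) \<partial>G)"
    using f01 g01 by (intro nn_integral_cong) (simp add: ennreal_mult)
  also have "\<dots> = ennreal (\<integral>z. f 0 (s * z) * ?g (s * z) \<partial>G)"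
  proof (rule nn_integral_eq_integral)
    have fg: "0 \<le> f 0 z * ?g z" "f 0 z * ?g z \<le> 1" for z
      using f01[of 0 z] g01[of z] by (simp_all add: mult_le_one)
    then show "AE z in G. 0 \<le> f 0 (s * z) * ?g (s * z)" by simp
    show "integrable G (\<lambda>z. f 0 (s * z) * ?g (s * z))"
    proof (rule G.integrable_const_bound)
      show "AE z in G. norm (f 0 (s * z) * ?g (s * z)) \<le> 1"
        unfolding real_norm_def abs_of_nonneg[OF fg(1)] by (simp only: fg(2)) simp
    qed measurable
  qed
  also have "(\<integral>z. f 0 (s * z) * ?g (s * z) \<partial>G) = path_expectation (scaling_kernel G) (Suc n) f s"
    unfolding path_expectation.simps scaling_kernel_def[of G s] by (rule integral_distr[symmetric]) measurable
  finally show ?case .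
qed

text \<open>Independence and the common law make the joint law of \<open>\<xi> 1\<close>, ...,
  \<open>\<xi> n\<close> a product measure, and \<open>T\<^sub>0\<close> is almost surely the
  constant \<open>u\<close>. The identity map in \<open>distr\<close> only carries \<open>G\<close>
  from the half-line to the Borel sets of the line.\<close>

lemma tail_chain_path_expectation:
  fixes f :: "nat \<Rightarrow> real \<Rightarrow> real"
  assumes Q: "tail_chain_family Q G T\<^sub>0 \<xi>" and "u \<ge> 0"
    and f: "\<And>i. f i \<in> borel_measurable borel" "\<And>i z. f i z \<in> {0..1}"
  shows "(\<integral>\<omega>. (\<Prod>i<n. f i (tail_chain T\<^sub>0 \<xi> (Suc i) \<omega>)) \<partial>Q u)
       = path_expectation (scaling_kernel (distr G borel (\<lambda>z. z))) n f u"
\<comment> \<open>The case of no factors is treated apart: the product form of the joint law is used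
  for a nonempty index set, and that \<open>G\<close> is a probability measure is read off from
  \<open>\<xi> 1\<close>.\<close>
proof (cases "n = 0")
  case True
  interpret prob_space "Q u" using assms by (simp add: tail_chain_family_def)
  show ?thesis using True by (simp add: prob_space)
next
  case False
  interpret prob_space "Q u" using assms by (simp add: tail_chain_family_def)
  let ?Y = "\<lambda>n. if n = 0 then T\<^sub>0 else \<xi> n"
  let ?G = "distr G borel (\<lambda>z. z)"
  have ind: "indep_vars (\<lambda>_. halfline) ?Y UNIV" and T0: "AE \<omega> in Q u. T\<^sub>0 \<omega> = u"
    and dG: "\<And>n. n \<ge> 1 \<Longrightarrow> distr (Q u) halfline (\<xi> n) = G"
    using assms by (auto simp: tail_chain_family_def)
  have id [measurable]: "(\<lambda>z. z) \<in> halfline \<rightarrow>\<^sub>M (borel :: real measure)"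
    by (simp add: measurable_restrict_space1)
  have Yh: "?Y i \<in> Q u \<rightarrow>\<^sub>M halfline" for i
    using ind by (auto simp: indep_vars_def)
  have Y: "?Y i \<in> borel_measurable (Q u)" for i
    using measurable_compose[OF Yh[of i] id] by simp
  have \<xi>: "\<xi> i \<in> borel_measurable (Q u)" if "i \<ge> 1" for i using Y[of i] that by simp
  have T0_meas: "T\<^sub>0 \<in> borel_measurable (Q u)" using Y[of 0] by simp
  have "indep_vars (\<lambda>_. borel) ?Y UNIV"
    by (rule indep_vars_compose2[OF ind, where Y = "\<lambda>_ z. z"]) (rule id)
  then have ind': "indep_vars (\<lambda>_. borel) ?Y {0<..0 + n}"
    by (rule indep_vars_subset) simp
  have dY: "distr (Q u) borel (?Y i) = ?G" if "i \<in> {0<..0 + n}" for i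
  proof -
    have "?G = distr (distr (Q u) halfline (\<xi> i)) borel (\<lambda>z. z)" using that dG by simp
    also have "\<dots> = distr (Q u) borel (\<xi> i)"
      using Yh[of i] that by (subst distr_distr) (auto simp: comp_def)
    finally show ?thesis using that by simp
  qed
  have "distr (Q u) (\<Pi>\<^sub>M i\<in>{0<..0 + n}. borel) (\<lambda>x. \<lambda>i\<in>{0<..0 + n}. ?Y i x)
      = (\<Pi>\<^sub>M i\<in>{0<..0 + n}. distr (Q u) borel (?Y i))"
    by (rule indep_vars_iff_distr_eq_PiM[THEN iffD1, OF _ Y ind']) (use False in simp)
  also have "\<dots> = (\<Pi>\<^sub>M i\<in>{0<..0 + n}. ?G)"
    using dY by (intro PiM_cong) auto
  finally have law: "distr (Q u) (\<Pi>\<^sub>M i\<in>{0<..0 + n}. borel) (\<lambda>x. \<lambda>i\<in>{0<..0 + n}. ?Y i x) = (\<Pi>\<^sub>M i\<in>{0<..0 + n}. ?G)" .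
  have "prob_space (distr (Q u) borel (?Y 1))" by (rule prob_space_distr[OF Y])
  also have "distr (Q u) borel (?Y 1) = ?G" by (rule dY) (use False in simp)
  finally have G: "prob_space ?G" .
  have f01: "0 \<le> f i z" "f i z \<le> 1" for i z using f(2)[of i z] by auto
  let ?F = "\<lambda>x. ennreal (\<Prod>i<n. f i (u * (\<Prod>j\<in>{0<..0 + Suc i}. x j)))"
  have F_meas: "?F \<in> borel_measurable (\<Pi>\<^sub>M i\<in>{0<..0 + n}. borel)"
    by (intro measurable_compose[OF measurable_prod_partial_products[OF refl f(1)] measurable_ennreal]) auto
  have P0: "path_expectation (scaling_kernel ?G) n f u \<ge> 0"
    using path_expectation_range[of UNIV "scaling_kernel ?G" f u n] f
      prob_space_kernel[OF scaling_kernel_measurable[of ?G]] G by auto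
  have tc: "tail_chain T\<^sub>0 \<xi> i \<in> borel_measurable (Q u)" for i
    unfolding tail_chain_def[abs_def] by (intro borel_measurable_times borel_measurable_prod \<xi> T0_meas) auto
  have "(\<integral>\<omega>. (\<Prod>i<n. f i (tail_chain T\<^sub>0 \<xi> (Suc i) \<omega>)) \<partial>Q u)
      = enn2real (\<integral>\<^sup>+\<omega>. ennreal (\<Prod>i<n. f i (tail_chain T\<^sub>0 \<xi> (Suc i) \<omega>)) \<partial>Q u)"
    by (intro integral_eq_nn_integral borel_measurable_prod measurable_compose[OF tc f(1)] AE_I2 prod_nonneg f01)
  also have "(\<integral>\<^sup>+\<omega>. ennreal (\<Prod>i<n. f i (tail_chain T\<^sub>0 \<xi> (Suc i) \<omega>)) \<partial>Q u)
      = (\<integral>\<^sup>+\<omega>. ?F (\<lambda>i\<in>{0<..0 + n}. ?Y i \<omega>) \<partial>Q u)"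
  proof (rule nn_integral_cong_AE)
    show "AE \<omega> in Q u. ennreal (\<Prod>i<n. f i (tail_chain T\<^sub>0 \<xi> (Suc i) \<omega>)) = ?F (\<lambda>i\<in>{0<..0 + n}. ?Y i \<omega>)"
      using T0
    proof eventually_elim
      case (elim \<omega>)
      have "tail_chain T\<^sub>0 \<xi> (Suc i) \<omega> = u * (\<Prod>j\<in>{0<..0 + Suc i}. (\<lambda>i\<in>{0<..0 + n}. ?Y i \<omega>) j)" if "i < n" for i
        unfolding tail_chain_def elim using that by (intro arg_cong2[of _ _ _ _ "(*)"] prod.cong) auto
      then show ?case by simp
    qed
  qed
  also have "\<dots> = (\<integral>\<^sup>+x. ?F x \<partial>(\<Pi>\<^sub>M i\<in>{0<..0 + n}. ?G))"
    unfolding law[symmetric] using F_meas Y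
    by (subst nn_integral_distr) (auto intro!: measurable_restrict)
  also have "\<dots> = ennreal (path_expectation (scaling_kernel ?G) n f u)"
    by (rule path_expectation_scaling_kernel) (use G f in auto)
  finally show ?thesis using P0 by simp
qed

section \<open>Convergence of rescaled path expectations\<close>

text \<open>0 is absorbing: \<open>scaling_kernel G 0\<close> is the point mass at 0.\<close>

lemma path_expectation_scaling_kernel_0:
  assumes G: "prob_space G" "sets G = sets borel" and "\<And>i. f i \<in> borel_measurable borel"
  shows "path_expectation (scaling_kernel G) n f 0 = (\<Prod>i<n. f i 0)"
  using assms(3)
proof (induction n arbitrary: f)
  case (Suc n)
  interpret prob_space G by fact
  have [measurable]: "path_expectation (scaling_kernel G) n (\<lambda>i. f (Suc i)) \<in> borel_measurable borel"
    by (rule measurable_path_expectation[OF scaling_kernel_measurable[OF G] Suc.prems])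
  note [measurable] = Suc.prems
  have "scaling_kernel G 0 = distr G borel (\<lambda>_. 0)"
    unfolding scaling_kernel_def by (rule distr_cong) simp_all
  then have "scaling_kernel G 0 = return borel 0" by (simp add: distr_const)
  then show ?case
    by (simp add: integral_return Suc prod.lessThan_Suc_shift del: prod.lessThan_Suc)
qed simp

text \<open>Kernels on the whole line that charge only the half-line, so that weak convergence and
  Skorohod's representation are available in the form for real distributions. \<open>G\<close> plays
  the part of the limit law.\<close>

locale real_kernel =
  fixes L :: "real \<Rightarrow> real measure" and G :: "real measure"
  assumes kernel: "L \<in> borel \<rightarrow>\<^sub>M prob_algebra borel"
    and kernel_nonneg: "AE z in L x. 0 \<le> z"
    and G: "real_distribution G" and G_nonneg: "AE z in G. 0 \<le> z"
begin

lemma L: "prob_space (L x)" "sets (L x) = sets borel"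
  using prob_space_kernel[OF kernel, of x] by auto

lemma G': "prob_space G" "sets G = sets borel"
  using G by (auto simp: real_distribution_def real_distribution_axioms_def)

lemma real_distribution_rescaled: "real_distribution (distr (L s) borel (\<lambda>z. z / t))"
proof -
  interpret prob_space "L s" by (rule L)
  note [measurable_cong] = L(2)
  show ?thesis by (rule real_distribution_distr) measurable
qed

lemma rescaled_nonneg: "t > 0 \<Longrightarrow> AE z in distr (L s) borel (\<lambda>z. z / t). 0 \<le> z"
proof -
  assume "t > 0"
  note [measurable_cong] = L(2)
  show ?thesis using kernel_nonneg[of s] \<open>t > 0\<close> by (subst AE_distr_iff) auto
qed

text \<open>For a chain with kernel \<open>L\<close> started at t u, the expectation of f 0 (X_1 /
  t) ... f (n-1) (X_n / t).\<close>

definition rescaled_expectation :: "nat \<Rightarrow> (nat \<Rightarrow> real \<Rightarrow> real) \<Rightarrow> real \<Rightarrow> real \<Rightarrow> real" where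
  "rescaled_expectation n f t u = path_expectation L n (\<lambda>i z. f i (z / t)) (t * u)"

context
  fixes t :: "nat \<Rightarrow> real"
  assumes t_pos: "\<And>k. 0 < t k" and t_lim: "filterlim t at_top sequentially"
begin

lemma rescaled_meas:
  assumes "\<And>i. f i \<in> borel_measurable borel"
  shows "(\<lambda>w. rescaled_expectation n f s (w * c)) \<in> borel_measurable borel"
proof -
  have [measurable]: "path_expectation L n (\<lambda>i z. f i (z / s)) \<in> borel_measurable borel"
    using assms by (intro measurable_path_expectation[OF kernel]) auto
  show ?thesis unfolding rescaled_expectation_def by measurable
qed

lemma path_range:
  assumes "\<And>i z. f i z \<in> {0..1}"
  shows "path_expectation L n f x \<in> {0..1}"
  by (rule path_expectation_range[of UNIV]) (use assms L in auto)

lemma rescaled_range: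
  assumes "\<And>i z. f i z \<in> {0..1}"
  shows "rescaled_expectation n f s w \<in> {0..1}"
  unfolding rescaled_expectation_def by (rule path_range) (rule assms)

text \<open>Two scales are kept apart: \<open>r\<close> for the starting point and the test
  functions, \<open>s\<close> for the first step. Near 0 the choice is s = r. For starting points
  with a positive limit it is s = r v, the scale on which the domain of attraction speaks; the
  quotient s / r then converts the rescaled state back.\<close>

lemma rescaled_Suc:
  assumes "s > 0" "r > 0" and f: "\<And>i. f i \<in> borel_measurable borel"
  shows "rescaled_expectation (Suc n) f r v =
    (\<integral>w. f 0 (w * (s / r)) * rescaled_expectation n (\<lambda>i. f (Suc i)) r (w * (s / r)) \<partial>distr (L (r * v)) borel (\<lambda>z. z / s))"
proof -
  note [measurable_cong] = L(2)
  note [measurable] = f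
  have [measurable]: "path_expectation L n (\<lambda>i z. f (Suc i) (z / r)) \<in> borel_measurable borel"
    by (intro measurable_path_expectation[OF kernel]) measurable
  show ?thesis
    using assms(1,2) by (subst integral_distr) (auto simp: rescaled_expectation_def)
qed

text \<open>From a fixed state every later state is finite, so divided by \<open>t k\<close> it
  tends to 0, and dominated convergence applies at each step. The case of interest is the start at
  0, which describes the path after an exact visit to 0.\<close>

lemma rescaled_fixed_limit:
  assumes "\<And>i. continuous_on UNIV (f i)" "\<And>i z. f i z \<in> {0..1}"
  shows "(\<lambda>k. path_expectation L n (\<lambda>i z. f i (z / t k)) x) \<longlonglongrightarrow> (\<Prod>i<n. f i 0)"
  using assms
proof (induction n arbitrary: f x)
  case (Suc n)
  interpret prob_space "L x" by (rule L)
  note [measurable_cong] = L(2)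
  have [measurable]: "f i \<in> borel_measurable borel" for i
    by (rule borel_measurable_continuous_onI[OF Suc.prems(1)])
  have [measurable]: "path_expectation L n (\<lambda>i z. f (Suc i) (z / t k)) \<in> borel_measurable borel" for k
    by (intro measurable_path_expectation[OF kernel]) measurable
  let ?g = "\<lambda>k z. f 0 (z / t k) * path_expectation L n (\<lambda>i z. f (Suc i) (z / t k)) z"
  have 1: "(\<lambda>k. f 0 (z / t k)) \<longlonglongrightarrow> f 0 0" for z
  proof -
    have "(\<lambda>k. z / t k) \<longlonglongrightarrow> 0"
      by (rule tendsto_divide_0[OF tendsto_const filterlim_at_top_imp_at_infinity[OF t_lim]])
    then show ?thesis
      using continuous_on_tendsto_compose[OF Suc.prems(1)] by auto
  qed
  have 2: "(\<lambda>k. path_expectation L n (\<lambda>i z. f (Suc i) (z / t k)) z) \<longlonglongrightarrow> (\<Prod>i<n. f (Suc i) 0)" for z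
    using Suc.prems by (intro Suc.IH) auto
  have "norm (?g k z) \<le> 1" for k z
    using Suc.prems(2)[of 0 "z / t k"] path_range[of "\<lambda>i z. f (Suc i) (z / t k)" n z, OF Suc.prems(2)]
    by (auto intro: mult_le_one)
  then have "(\<lambda>k. \<integral>z. ?g k z \<partial>L x) \<longlonglongrightarrow> (\<integral>z. f 0 0 * (\<Prod>i<n. f (Suc i) 0) \<partial>L x)"
    using tendsto_mult[OF 1 2] by (intro integral_dominated_convergence[where w = "\<lambda>_. 1"]) auto
  then show ?case
    by (simp add: prod.lessThan_Suc_shift prob_space del: prod.lessThan_Suc)
qed simp

text \<open>The regularity condition in sequential form, relative to the scales
  \<open>t k\<close>.\<close>

definition attracted_at_0 :: bool where
  "attracted_at_0 \<longleftrightarrow> (\<forall>u. (\<forall>k. 0 \<le> u k) \<longrightarrow> u \<longlonglongrightarrow> 0 \<longrightarrow>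
     weak_conv_m (\<lambda>k. distr (L (t k * u k)) borel (\<lambda>z. z / t k)) (return borel 0))"

text \<open>The first step collapses to 0 under \<open>attracted_at_0\<close>, so the integrand
  matters only along sequences tending to 0, and there the induction hypothesis applies to the next
  starting point.\<close>

lemma rescaled_limit_at_0:
  assumes "attracted_at_0"
    and "\<And>i. continuous_on UNIV (f i)" "\<And>i z. f i z \<in> {0..1}" "\<And>k. 0 \<le> u k" "u \<longlonglongrightarrow> 0"
  shows "(\<lambda>k. rescaled_expectation n f (t k) (u k)) \<longlonglongrightarrow> (\<Prod>i<n. f i 0)"
  using assms(2-)
proof (induction n arbitrary: f u)
  case 0
  then show ?case by (simp add: rescaled_expectation_def)
next
  case (Suc n)
  have f_meas [measurable]: "f i \<in> borel_measurable borel" for i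
    by (rule borel_measurable_continuous_onI[OF Suc.prems(1)])
  let ?h = "\<lambda>k w. f 0 w * rescaled_expectation n (\<lambda>i. f (Suc i)) (t k) w"
  let ?c = "f 0 0 * (\<Prod>i<n. f (Suc i) 0)"
  note [measurable] = rescaled_meas[of "\<lambda>i. f (Suc i)" n _ 1, OF f_meas, simplified]
  have f01: "0 \<le> f i z" "f i z \<le> 1" for i z using Suc.prems(2)[of i z] by auto
  have "(\<lambda>k. \<integral>w. ?h k w \<partial>distr (L (t k * u k)) borel (\<lambda>z. z / t k)) \<longlonglongrightarrow> (\<integral>w. ?c \<partial>return borel (0::real))"
  proof (rule extended_continuous_mapping[where B = 1 and h = ?h and h' = "\<lambda>_. ?c"])
    show "weak_conv_m (\<lambda>k. distr (L (t k * u k)) borel (\<lambda>z. z / t k)) (return borel 0)"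
      using assms(1) Suc.prems unfolding attracted_at_0_def by auto
    show "real_distribution (return borel 0)"
      by (simp add: real_distribution_def real_distribution_axioms_def prob_space_return)
    show "\<bar>?h k w\<bar> \<le> 1" for k w
      using f01[of 0 w] rescaled_range[of "\<lambda>i. f (Suc i)" n "t k" w, OF Suc.prems(2)]
      by (auto simp: abs_mult intro: mult_le_one)
    show "\<bar>?c\<bar> \<le> 1"
      using f01 by (auto simp: abs_mult abs_prod intro!: mult_le_one prod_le_1 prod_nonneg)
    \<comment> \<open>The limit law charges only 0, so the condition at positive points is
      vacuous.\<close>
    have "AE w in return borel (0::real). w = 0" by (simp add: AE_return)
    then show "AE w in return borel 0. 0 < w \<longrightarrow>
        (\<forall>zs. (\<forall>k. 0 \<le> zs k) \<longrightarrow> zs \<longlonglongrightarrow> w \<longrightarrow> (\<lambda>k. ?h k (zs k)) \<longlonglongrightarrow> ?c)"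
      by eventually_elim simp
    have "(\<lambda>k. ?h k (w k)) \<longlonglongrightarrow> ?c" if "\<And>k. 0 \<le> w k" "w \<longlonglongrightarrow> 0" for w
      using that Suc.prems(1,2)
      by (intro tendsto_mult Suc.IH continuous_on_tendsto_compose[OF Suc.prems(1)[of 0]]) auto
    then show "(\<forall>zs. (\<forall>k. 0 \<le> zs k) \<longrightarrow> zs \<longlonglongrightarrow> 0 \<longrightarrow> (\<lambda>k. ?h k (zs k)) \<longlonglongrightarrow> ?c) \<or>
      (\<lambda>k. measure (distr (L (t k * u k)) borel (\<lambda>z. z / t k)) {0}) \<longlonglongrightarrow> measure (return borel 0) {0} \<and> (\<lambda>k. ?h k 0) \<longlonglongrightarrow> ?c"
      by auto
  qed (auto intro!: real_distribution_rescaled rescaled_nonneg t_pos simp: AE_return)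
  moreover have "(\<integral>w. ?c \<partial>return borel (0::real)) = (\<Prod>i<Suc n. f i 0)"
    by (subst integral_return) (simp_all add: prod.lessThan_Suc_shift del: prod.lessThan_Suc)
  moreover have "rescaled_expectation (Suc n) f (t k) (u k) = (\<integral>w. ?h k w \<partial>distr (L (t k * u k)) borel (\<lambda>z. z / t k))" for k
    using rescaled_Suc[OF t_pos[of k] t_pos[of k] f_meas, where n = n and v = "u k"] t_pos[of k] by simp
  ultimately show ?case by simp
qed

text \<open>If the next rescaled state w_k tends to w > 0, the remaining path starts at w_k u_k,
  which tends to v w > 0. The induction hypothesis is thus precisely the continuous convergence that
  \<open>extended_continuous_mapping\<close> asks for at positive points, and \<open>alt\<close>
  supplies one of its two ways of treating 0.\<close>

lemma rescaled_limit:
  assumes doa: "\<And>s. (\<And>k. 0 < s k) \<Longrightarrow> filterlim s at_top sequentially \<Longrightarrow>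
      weak_conv_m (\<lambda>k. distr (L (s k)) borel (\<lambda>z. z / s k)) G"
    and alt: "(\<forall>s. filterlim s at_top sequentially \<longrightarrow> (\<lambda>k. measure (L (s k)) {0}) \<longlonglongrightarrow> measure G {0}) \<or> attracted_at_0"
    and "\<And>i. continuous_on UNIV (f i)" "\<And>i z. f i z \<in> {0..1}" "\<And>k. 0 \<le> u k" "u \<longlonglongrightarrow> v" "0 < v"
  shows "(\<lambda>k. rescaled_expectation n f (t k) (u k)) \<longlonglongrightarrow> path_expectation (scaling_kernel G) n f v"
  using assms(3-)
proof (induction n arbitrary: f u v)
  case 0
  then show ?case by (simp add: rescaled_expectation_def)
next
  case (Suc n)
  have f_meas [measurable]: "f i \<in> borel_measurable borel" for i
    by (rule borel_measurable_continuous_onI[OF Suc.prems(1)])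
  have f01: "0 \<le> f i z" "f i z \<le> 1" for i z using Suc.prems(2)[of i z] by auto
  \<comment> \<open>Finitely many \<open>u k\<close> may be 0; the default \<open>v\<close> there
    keeps the scale \<open>t k * u' k\<close> positive without changing the limit.\<close>
  define u' where "u' k = (if 0 < u k then u k else v)" for k
  have u'_pos: "0 < u' k" for k using \<open>0 < v\<close> by (simp add: u'_def)
  have u'_eq: "\<forall>\<^sub>F k in sequentially. u' k = u k"
    using order_tendstoD(1)[OF \<open>u \<longlonglongrightarrow> v\<close> \<open>0 < v\<close>] by eventually_elim (simp add: u'_def)
  have u'_lim: "u' \<longlonglongrightarrow> v"
    using \<open>u \<longlonglongrightarrow> v\<close> u'_eq by (simp add: tendsto_cong)
  have s_pos: "0 < t k * u' k" for k using t_pos u'_pos by simp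
  have s_lim: "filterlim (\<lambda>k. t k * u' k) at_top sequentially"
    using filterlim_tendsto_pos_mult_at_top[OF u'_lim \<open>0 < v\<close> t_lim] by (simp add: mult.commute)
  let ?\<Phi> = "rescaled_expectation n (\<lambda>i. f (Suc i))"
  let ?\<Psi> = "path_expectation (scaling_kernel G) n (\<lambda>i. f (Suc i))"
  \<comment> \<open>The variable w is the next state divided by \<open>t k * u' k\<close>, so on
    scale \<open>t k\<close> it reads \<open>w * u' k\<close>.\<close>
  let ?h = "\<lambda>k w. f 0 (w * u' k) * ?\<Phi> (t k) (w * u' k)"
  let ?h' = "\<lambda>w. f 0 (v * w) * ?\<Psi> (v * w)"
  let ?\<nu> = "\<lambda>k. distr (L (t k * u' k)) borel (\<lambda>z. z / (t k * u' k))"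
  note [measurable] = rescaled_meas[of "\<lambda>i. f (Suc i)" n, OF f_meas]
  have [measurable]: "?\<Psi> \<in> borel_measurable borel"
    by (intro measurable_path_expectation[OF scaling_kernel_measurable[OF G']]) measurable
  have \<Psi>01: "?\<Psi> z \<in> {0..1}" for z
    by (rule path_expectation_range[of UNIV])
       (use prob_space_kernel[OF scaling_kernel_measurable[OF G']] Suc.prems in auto)
  have f0_lim: "(\<lambda>k. f 0 (w k * u' k)) \<longlonglongrightarrow> f 0 (v * z)" if "w \<longlonglongrightarrow> z" for w z
    by (rule continuous_on_tendsto_compose[OF Suc.prems(1)[of 0]])
       (use tendsto_mult[OF that u'_lim] in \<open>simp_all add: mult.commute\<close>)
  have "(\<lambda>k. \<integral>w. ?h k w \<partial>?\<nu> k) \<longlonglongrightarrow> (\<integral>w. ?h' w \<partial>G)"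
  proof (rule extended_continuous_mapping[where B = 1])
    show "weak_conv_m ?\<nu> G" by (rule doa[OF s_pos s_lim])
    show "\<bar>?h k w\<bar> \<le> 1" for k w
      using f01[of 0 "w * u' k"] rescaled_range[of "\<lambda>i. f (Suc i)" n "t k" "w * u' k", OF Suc.prems(2)]
      by (auto simp: abs_mult intro: mult_le_one)
    show "\<bar>?h' w\<bar> \<le> 1" for w
      using f01[of 0 "v * w"] \<Psi>01[of "v * w"] by (auto simp: abs_mult intro: mult_le_one)
    show "AE z in G. 0 < z \<longrightarrow> (\<forall>zs. (\<forall>k. 0 \<le> zs k) \<longrightarrow> zs \<longlonglongrightarrow> z \<longrightarrow> (\<lambda>k. ?h k (zs k)) \<longlonglongrightarrow> ?h' z)"
    proof (intro AE_I2 impI allI)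
      fix z :: real and zs :: "nat \<Rightarrow> real" assume z: "0 < z" "\<forall>k. 0 \<le> zs k" "zs \<longlonglongrightarrow> z"
      have "(\<lambda>k. ?\<Phi> (t k) (zs k * u' k)) \<longlonglongrightarrow> ?\<Psi> (v * z)"
        using Suc.prems(1,2) z \<open>0 < v\<close> less_imp_le[OF u'_pos] tendsto_mult[OF z(3) u'_lim]
        by (intro Suc.IH) (auto simp: mult.commute)
      with f0_lim[OF z(3)] show "(\<lambda>k. ?h k (zs k)) \<longlonglongrightarrow> ?h' z" by (rule tendsto_mult)
    qed
    \<comment> \<open>A tail chain that has reached 0 stays there; this is the common target of both
      alternatives at 0.\<close>
    have \<Psi>0: "?\<Psi> (v * 0) = (\<Prod>i<n. f (Suc i) 0)"
      using path_expectation_scaling_kernel_0[OF G' f_meas] by simp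
    from alt show "(\<forall>zs. (\<forall>k. 0 \<le> zs k) \<longrightarrow> zs \<longlonglongrightarrow> 0 \<longrightarrow> (\<lambda>k. ?h k (zs k)) \<longlonglongrightarrow> ?h' 0) \<or>
      (\<lambda>k. measure (?\<nu> k) {0}) \<longlonglongrightarrow> measure G {0} \<and> (\<lambda>k. ?h k 0) \<longlonglongrightarrow> ?h' 0"
    proof
      assume z: "\<forall>s. filterlim s at_top sequentially \<longrightarrow> (\<lambda>k. measure (L (s k)) {0}) \<longlonglongrightarrow> measure G {0}"
      have "measure (?\<nu> k) {0} = measure (L (t k * u' k)) {0}" for k
      proof -
        note [measurable_cong] = L(2)
        have "(\<lambda>z. z / (t k * u' k)) -` {0} \<inter> space (L (t k * u' k)) = {0}"
          using s_pos[of k] sets_eq_imp_space_eq[OF L(2)[of "t k * u' k"]] by auto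
        then show ?thesis by (subst measure_distr) auto
      qed
      then have "(\<lambda>k. measure (?\<nu> k) {0}) \<longlonglongrightarrow> measure G {0}" using z s_lim by simp
      \<comment> \<open>After an exact visit to 0 the rest of the path starts from a fixed
        state.\<close>
      moreover have "(\<lambda>k. ?\<Phi> (t k) (0 * u' k)) \<longlonglongrightarrow> ?\<Psi> (v * 0)"
        using rescaled_fixed_limit[of "\<lambda>i. f (Suc i)" n 0] Suc.prems(1,2) \<Psi>0
        by (simp add: rescaled_expectation_def)
      with f0_lim[OF tendsto_const] have "(\<lambda>k. ?h k 0) \<longlonglongrightarrow> ?h' 0" by (rule tendsto_mult)
      ultimately show ?thesis by blast
    next
      assume a: attracted_at_0
      have "(\<lambda>k. ?h k (zs k)) \<longlonglongrightarrow> ?h' 0" if zs: "\<forall>k. 0 \<le> zs k" "zs \<longlonglongrightarrow> 0" for zs :: "nat \<Rightarrow> real"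
      proof (rule tendsto_mult[OF f0_lim[OF zs(2)]])
        show "(\<lambda>k. ?\<Phi> (t k) (zs k * u' k)) \<longlonglongrightarrow> ?\<Psi> (v * 0)"
          unfolding \<Psi>0 using Suc.prems(1,2) zs less_imp_le[OF u'_pos] tendsto_mult[OF zs(2) u'_lim]
          by (intro rescaled_limit_at_0[OF a]) auto
      qed
      then show ?thesis by blast
    qed
  qed (auto intro!: real_distribution_rescaled rescaled_nonneg s_pos G G_nonneg)
  moreover have "rescaled_expectation (Suc n) f (t k) (u' k) = (\<integral>w. ?h k w \<partial>?\<nu> k)" for k
    using rescaled_Suc[OF s_pos[of k] t_pos[of k] f_meas, where n = n and v = "u' k"] t_pos[of k] by simp
  moreover have "(\<integral>w. ?h' w \<partial>G) = path_expectation (scaling_kernel G) (Suc n) f v"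
  proof -
    note [measurable_cong] = G'(2)
    show ?thesis
      unfolding path_expectation.simps scaling_kernel_def[of G v] by (rule integral_distr[symmetric]) measurable
  qed
  ultimately have "(\<lambda>k. rescaled_expectation (Suc n) f (t k) (u' k)) \<longlonglongrightarrow> path_expectation (scaling_kernel G) (Suc n) f v"
    by simp
  then show ?case
    by (rule Lim_transform_eventually) (use u'_eq in eventually_elim, simp)
qed

end

end

section \<open>Attraction and regularity as weak convergence of real measures\<close>

text \<open>The ramp \<open>cts_step a b\<close> continued to infinity by its final value 0.
  Truncation at \<open>max b 0\<close> does not change it, as the ramp vanishes from b on, and it
  makes the argument finite, so that \<open>enn2real\<close> is continuous along it.\<close>

definition ennreal_step :: "real \<Rightarrow> real \<Rightarrow> ennreal \<Rightarrow> real" where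
  "ennreal_step a b z = cts_step a b (enn2real (min z (ennreal (max b 0))))"

lemma ennreal_step_ennreal:
  assumes "a < b" "0 \<le> z"
  shows "ennreal_step a b (ennreal z) = cts_step a b z"
proof -
  have "min (ennreal z) (ennreal (max b 0)) = ennreal (min z (max b 0))"
    by (rule min_of_mono) (simp add: mono_def ennreal_leI)
  then have "ennreal_step a b (ennreal z) = cts_step a b (min z (max b 0))"
    using assms by (simp only: ennreal_step_def enn2real_ennreal min.boundedI max.cobounded2)
  then show ?thesis using assms by (auto simp: cts_step_def min_def max_def)
qed

lemma cts_step_range: "a < b \<Longrightarrow> cts_step a b x \<in> {0..1}"
  by (auto simp: cts_step_def divide_simps)

lemma continuous_on_cts_step: "a < b \<Longrightarrow> continuous_on S (cts_step a b)"
  by (rule continuous_on_subset[OF uniformly_continuous_imp_continuous[OF cts_step_uniformly_continuous]]) auto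

lemma ennreal_step_range: "a < b \<Longrightarrow> ennreal_step a b z \<in> {0..1}"
  unfolding ennreal_step_def by (rule cts_step_range)

lemma continuous_on_ennreal_step:
  assumes "a < b"
  shows "continuous_on S (ennreal_step a b)"
proof -
  let ?c = "ennreal (max b 0)"
  have "continuous_on UNIV (\<lambda>z. enn2real (min z ?c))"
    unfolding continuous_on_def
  proof
    fix x :: ennreal
    have "min x ?c < \<top>" by (simp add: min_less_iff_disj)
    then have "((\<lambda>z. min z ?c) \<longlongrightarrow> ennreal (enn2real (min x ?c))) (at x)"
      by (simp only: ennreal_enn2real) (intro tendsto_intros)
    then show "((\<lambda>z. enn2real (min z ?c)) \<longlongrightarrow> enn2real (min x ?c)) (at x)"
      by (rule tendsto_enn2real) simp
  qed
  then have "continuous_on UNIV (ennreal_step a b)"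
    unfolding ennreal_step_def[abs_def]
    by (intro continuous_on_compose2[OF continuous_on_cts_step[OF assms, of UNIV]]) auto
  then show ?thesis by (rule continuous_on_subset) simp
qed

text \<open>Ramps suffice for weak convergence of real distributions, and each ramp extends
  continuously to [0,\<infinity>]. The limit \<open>N\<close> is a law on the reals, so no mass is
  lost at infinity.\<close>

lemma weak_conv_m_ennrealI:
  assumes M: "\<And>n. real_distribution (M n)" "real_distribution N"
    and nonneg: "\<And>n. AE z in M n. 0 \<le> z" "AE z in N. 0 \<le> z"
    and lim: "\<And>\<phi> :: ennreal \<Rightarrow> real. continuous_on UNIV \<phi> \<Longrightarrow> bounded (range \<phi>) \<Longrightarrow>
      (\<lambda>n. \<integral>z. \<phi> (ennreal z) \<partial>M n) \<longlonglongrightarrow> (\<integral>z. \<phi> (ennreal z) \<partial>N)"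
  shows "weak_conv_m M N"
proof (rule integral_cts_step_conv_imp_weak_conv[OF M])
  fix a b :: real assume "a < b"
  have [measurable]: "ennreal_step a b \<in> borel_measurable borel" "cts_step a b \<in> borel_measurable borel"
    using \<open>a < b\<close> by (auto intro!: borel_measurable_continuous_onI continuous_on_ennreal_step continuous_on_cts_step)
  have eq: "(\<integral>z. ennreal_step a b (ennreal z) \<partial>D) = integral\<^sup>L D (cts_step a b)"
    if "real_distribution D" "AE z in D. 0 \<le> z" for D
  proof (rule integral_cong_AE)
    note [measurable_cong] = real_distribution.events_eq_borel[OF that(1)]
    show "(\<lambda>z. ennreal_step a b (ennreal z)) \<in> borel_measurable D" "cts_step a b \<in> borel_measurable D"
      by measurable
    show "AE z in D. ennreal_step a b (ennreal z) = cts_step a b z"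
      using that(2) by eventually_elim (simp add: ennreal_step_ennreal \<open>a < b\<close>)
  qed
  have "bounded (range (ennreal_step a b))"
    by (rule bounded_subset[OF bounded_closed_interval[of 0 1]]) (use ennreal_step_range[OF \<open>a < b\<close>] in auto)
  from lim[OF continuous_on_ennreal_step[OF \<open>a < b\<close>] this]
  show "(\<lambda>n. integral\<^sup>L (M n) (cts_step a b)) \<longlonglongrightarrow> integral\<^sup>L N (cts_step a b)"
    using M nonneg by (simp add: eq)
qed

section \<open>Passage from kernels on the half-line to kernels on the real line\<close>

lemma halfline_to_borel: "f \<in> borel_measurable borel \<Longrightarrow> f \<in> borel_measurable halfline"
  by (rule measurable_restrict_space1)

lemma halfline_id: "(\<lambda>z. z) \<in> halfline \<rightarrow>\<^sub>M borel"
  by (rule halfline_to_borel) simp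

lemma space_halfline: "space halfline = {0..}"
  by (simp add: space_restrict_space)

text \<open>Negative states, where nothing is known of \<open>K\<close>, get the law
  \<open>K 0\<close>. This keeps the kernel measurable on the line, and a chain started at a
  nonnegative state does not visit them.\<close>

definition line_kernel :: "(real \<Rightarrow> real measure) \<Rightarrow> real \<Rightarrow> real measure" where
  "line_kernel K x = distr (K (max 0 x)) borel (\<lambda>z. z)"

context
  fixes G :: "real measure" and K :: "real \<Rightarrow> real measure"
  assumes G: "G \<in> space (prob_algebra halfline)"
    and K: "K \<in> halfline \<rightarrow>\<^sub>M prob_algebra halfline"
begin

lemma K_at: "0 \<le> x \<Longrightarrow> prob_space (K x)" "0 \<le> x \<Longrightarrow> sets (K x) = sets halfline" "0 \<le> x \<Longrightarrow> space (K x) = {0..}"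
  using prob_space_kernel[OF K, of x] sets_eq_imp_space_eq[of "K x" halfline] by (auto simp: space_halfline)

lemma G_at: "prob_space G" "sets G = sets halfline" "space G = {0..}"
  using G sets_eq_imp_space_eq[of G halfline] by (auto simp: space_prob_algebra space_halfline)

lemma integral_line_kernel:
  fixes g :: "real \<Rightarrow> real"
  assumes "0 \<le> x" "g \<in> borel_measurable borel"
  shows "(\<integral>z. g z \<partial>line_kernel K x) = (\<integral>z. g z \<partial>K x)"
proof -
  note [measurable_cong] = K_at(2)[OF assms(1)]
  note [measurable] = assms(2) halfline_id
  show ?thesis unfolding line_kernel_def using assms(1) by (subst integral_distr) (auto simp: max_def)
qed

lemma line_kernel_measurable: "line_kernel K \<in> borel \<rightarrow>\<^sub>M prob_algebra borel"
proof -
  have "(\<lambda>x::real. max 0 x) \<in> borel \<rightarrow>\<^sub>M halfline"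
    by (rule measurable_restrict_space2) auto
  from measurable_compose[OF this K]
  have "(\<lambda>x. K (max 0 x)) \<in> borel \<rightarrow>\<^sub>M prob_algebra halfline" .
  from measurable_compose[OF this measurable_distr_prob_space[of "\<lambda>z. z" halfline borel]]
  show ?thesis unfolding line_kernel_def[abs_def] by (simp add: halfline_to_borel)
qed

lemma real_kernel_line_kernel: "real_kernel (line_kernel K) (distr G borel (\<lambda>z. z))"
proof (rule real_kernel.intro)
  show "line_kernel K \<in> borel \<rightarrow>\<^sub>M prob_algebra borel" by (rule line_kernel_measurable)
  show "AE z in line_kernel K x. 0 \<le> z" for x
  proof -
    note [measurable_cong] = K_at(2)[of "max 0 x"]
    note [measurable] = halfline_id
    show ?thesis unfolding line_kernel_def
      by (subst AE_distr_iff) (auto simp: K_at(3) intro!: AE_I2)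
  qed
  note [measurable_cong] = G_at(2)
  note [measurable] = halfline_id
  interpret prob_space G by (rule G_at)
  show "real_distribution (distr G borel (\<lambda>z. z))" by (rule real_distribution_distr) measurable
  show "AE z in distr G borel (\<lambda>z. z). 0 \<le> z"
    by (subst AE_distr_iff) (auto simp: G_at(3) intro!: AE_I2)
qed

lemma path_expectation_line_kernel:
  assumes "0 \<le> x" "\<And>i. f i \<in> borel_measurable borel"
  shows "path_expectation (line_kernel K) n f x = path_expectation K n f x"
  using assms
proof (induction n arbitrary: f x)
  case (Suc n)
  note [measurable] = Suc.prems(2) measurable_path_expectation[OF line_kernel_measurable, of "\<lambda>i. f (Suc i)" n, OF Suc.prems(2)]
  have "path_expectation (line_kernel K) (Suc n) f x
      = (\<integral>z. f 0 z * path_expectation (line_kernel K) n (\<lambda>i. f (Suc i)) z \<partial>K x)"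
    unfolding path_expectation.simps by (rule integral_line_kernel[OF Suc.prems(1)]) measurable
  also have "\<dots> = path_expectation K (Suc n) f x"
    unfolding path_expectation.simps
    by (rule Bochner_Integration.integral_cong) (use Suc.prems K_at(3) in \<open>auto simp: Suc.IH\<close>)
  finally show ?case .
qed simp

lemma integral_scaled_kernel:
  fixes \<phi> :: "ennreal \<Rightarrow> real"
  assumes "0 \<le> s" "0 < t" "\<phi> \<in> borel_measurable borel"
  shows "(\<integral>z. \<phi> z \<partial>scaled_kernel K s t) = (\<integral>z. \<phi> (ennreal z) \<partial>distr (line_kernel K s) borel (\<lambda>z. z / t))"
proof -
  note [measurable_cong] = K_at(2)[OF assms(1)]
  note [measurable] = assms(3) halfline_id
  have div: "(\<lambda>z. z / t) \<in> line_kernel K s \<rightarrow>\<^sub>M borel" by (simp add: line_kernel_def)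
  have "(\<integral>z. \<phi> (ennreal z) \<partial>distr (line_kernel K s) borel (\<lambda>z. z / t)) = (\<integral>z. \<phi> (ennreal (z / t)) \<partial>line_kernel K s)"
    by (rule integral_distr[OF div]) measurable
  also have "\<dots> = (\<integral>z. \<phi> (ennreal (z / t)) \<partial>K s)"
    by (rule integral_line_kernel[OF assms(1)]) measurable
  also have "\<dots> = (\<integral>z. \<phi> z \<partial>scaled_kernel K s t)"
    unfolding scaled_kernel_def by (subst integral_distr) auto
  finally show ?thesis by simp
qed

lemma attraction_weak_conv:
  assumes doa: "in_domain_of_attraction K G" and s: "\<And>k. 0 < s k" "filterlim s at_top sequentially"
  shows "weak_conv_m (\<lambda>k. distr (line_kernel K (s k)) borel (\<lambda>z. z / s k)) (distr G borel (\<lambda>z. z))"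
proof -
  interpret real_kernel "line_kernel K" "distr G borel (\<lambda>z. z)" by (rule real_kernel_line_kernel)
  show ?thesis
  proof (rule weak_conv_m_ennrealI)
    fix \<phi> :: "ennreal \<Rightarrow> real" assume \<phi>: "continuous_on UNIV \<phi>" "bounded (range \<phi>)"
    then have [measurable]: "\<phi> \<in> borel_measurable borel" by (intro borel_measurable_continuous_onI)
    have "((\<lambda>t. \<integral>z. \<phi> z \<partial>scaled_kernel K t t) \<longlongrightarrow> (\<integral>z. \<phi> z \<partial>distr G borel ennreal)) at_top"
      using doa \<phi> unfolding in_domain_of_attraction_def weak_convergence_on_def by auto
    from filterlim_compose[OF this s(2)]
    have "(\<lambda>k. \<integral>z. \<phi> z \<partial>scaled_kernel K (s k) (s k)) \<longlonglongrightarrow> (\<integral>z. \<phi> z \<partial>distr G borel ennreal)" .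
    also have "(\<lambda>k. \<integral>z. \<phi> z \<partial>scaled_kernel K (s k) (s k)) = (\<lambda>k. \<integral>z. \<phi> (ennreal z) \<partial>distr (line_kernel K (s k)) borel (\<lambda>z. z / s k))"
      using s(1) by (intro ext integral_scaled_kernel) (auto intro: less_imp_le)
    also have "(\<integral>z. \<phi> z \<partial>distr G borel ennreal) = (\<integral>z. \<phi> (ennreal z) \<partial>distr G borel (\<lambda>z. z))"
    proof -
      note [measurable_cong] = G_at(2)
  note [measurable] = halfline_id
      show ?thesis by (subst (1 2) integral_distr) auto
    qed
    finally show "(\<lambda>k. \<integral>z. \<phi> (ennreal z) \<partial>distr (line_kernel K (s k)) borel (\<lambda>z. z / s k))
        \<longlonglongrightarrow> (\<integral>z. \<phi> (ennreal z) \<partial>distr G borel (\<lambda>z. z))" .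
  qed (use s real_kernel.G[OF real_kernel_line_kernel] in \<open>auto intro: real_distribution_rescaled rescaled_nonneg G_nonneg\<close>)
qed

text \<open>The regularity condition only speaks about functions \<open>u\<close> of \<open>t\<close>, so a sequence \<open>(t k, u k)\<close>
  with repeated values \<open>t k\<close> does not define one. Picking, for each \<open>t\<close>, an index at which the
  convergence fails (if there is one) does.\<close>

lemma regularity_weak_conv:
  assumes reg: "regularity_condition K"
    and t: "\<And>k. 0 < t k" "filterlim t at_top sequentially"
    and u: "\<And>k. 0 \<le> u k" "u \<longlonglongrightarrow> 0"
  shows "weak_conv_m (\<lambda>k. distr (line_kernel K (t k * u k)) borel (\<lambda>z. z / t k)) (return borel 0)"
proof -
  interpret real_kernel "line_kernel K" "distr G borel (\<lambda>z. z)" by (rule real_kernel_line_kernel)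
  show ?thesis
  proof (rule weak_conv_m_ennrealI)
    fix \<phi> :: "ennreal \<Rightarrow> real" assume \<phi>: "continuous_on UNIV \<phi>" "bounded (range \<phi>)"
    then have [measurable]: "\<phi> \<in> borel_measurable borel" by (intro borel_measurable_continuous_onI)
    have "(\<lambda>k. \<integral>z. \<phi> z \<partial>scaled_kernel K (t k * u k) (t k)) \<longlonglongrightarrow> \<phi> 0"
    proof (rule tendstoI)
      fix e :: real assume "e > 0"
      define bad where "bad r k \<longleftrightarrow> t k = r \<and> \<not> dist (\<integral>z. \<phi> z \<partial>scaled_kernel K (t k * u k) (t k)) (\<phi> 0) < e" for r k
      define v where "v r = (if \<exists>k. bad r k then u (SOME k. bad r k) else 0)" for r
      have v_some: "v r = u (SOME k. bad r k) \<and> bad r (SOME k. bad r k)" if "bad r k" for r k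
        using someI[of "bad r", OF that] that by (auto simp: v_def)
      have v_nonneg: "0 \<le> v r" for r by (simp add: v_def u)
      have v_lim: "(v \<longlongrightarrow> 0) at_top"
      proof (rule tendstoI)
        fix d :: real assume "d > 0"
        then obtain N where N: "\<And>k. k \<ge> N \<Longrightarrow> u k < d"
          using order_tendstoD(2)[OF u(2)] by (auto simp: eventually_sequentially)
        \<comment> \<open>Once r exceeds the scales of all indices below N, an index picked for r is
          at least N.\<close>
        have "\<forall>\<^sub>F r in at_top. Max (insert 0 (t ` {..<N})) < r" by (rule eventually_gt_at_top)
        then show "\<forall>\<^sub>F r in at_top. dist (v r) 0 < d"
        proof eventually_elim
          case (elim r)
          show ?case
          proof (cases "\<exists>k. bad r k")
            case True
            then obtain k where k: "bad r k" "v r = u k" using v_some by blast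
            have "k \<ge> N"
            proof (rule ccontr)
              assume "\<not> N \<le> k"
              then have "t k \<le> Max (insert 0 (t ` {..<N}))" by (intro Max_ge) auto
              moreover have "t k = r" using k by (simp add: bad_def)
              ultimately show False using elim by linarith
            qed
            then show ?thesis using N k u(1)[of k] by simp
          qed (use \<open>d > 0\<close> in \<open>simp add: v_def\<close>)
        qed
      qed
      have "weak_convergence_on euclidean (\<lambda>t. scaled_kernel K (t * v t) t) (return borel 0) at_top"
        using reg v_nonneg v_lim unfolding regularity_condition_def by auto
      then have "((\<lambda>t. \<integral>z. \<phi> z \<partial>scaled_kernel K (t * v t) t) \<longlongrightarrow> (\<integral>z. \<phi> z \<partial>return borel 0)) at_top"
        using \<phi> unfolding weak_convergence_on_def by auto
      from filterlim_compose[OF this t(2)]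
      have "(\<lambda>k. \<integral>z. \<phi> z \<partial>scaled_kernel K (t k * v (t k)) (t k)) \<longlonglongrightarrow> \<phi> 0"
        by (simp add: integral_return)
      from tendstoD[OF this \<open>e > 0\<close>]
      show "\<forall>\<^sub>F k in sequentially. dist (\<integral>z. \<phi> z \<partial>scaled_kernel K (t k * u k) (t k)) (\<phi> 0) < e"
      proof eventually_elim
        case (elim k)
        show ?case
        proof (rule ccontr)
          assume "\<not> ?case"
          then have "bad (t k) k" by (simp add: bad_def)
          from v_some[OF this] elim show False by (auto simp: bad_def)
        qed
      qed
    qed
    also have "(\<lambda>k. \<integral>z. \<phi> z \<partial>scaled_kernel K (t k * u k) (t k)) = (\<lambda>k. \<integral>z. \<phi> (ennreal z) \<partial>distr (line_kernel K (t k * u k)) borel (\<lambda>z. z / t k))"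
      using t(1) u(1) by (intro ext integral_scaled_kernel) (auto intro: less_imp_le mult_nonneg_nonneg)
    finally show "(\<lambda>k. \<integral>z. \<phi> (ennreal z) \<partial>distr (line_kernel K (t k * u k)) borel (\<lambda>z. z / t k))
        \<longlonglongrightarrow> (\<integral>z. \<phi> (ennreal z) \<partial>return borel 0)"
      by (simp add: integral_return)
  next
    show "real_distribution (return borel 0)"
      by (simp add: real_distribution_def real_distribution_axioms_def prob_space_return)
  qed (use t in \<open>auto intro: real_distribution_rescaled rescaled_nonneg simp: AE_return\<close>)
qed

lemma zero_boundary_measure:
  assumes "extremal_boundary K G (\<lambda>_. 0)" and s: "filterlim s at_top sequentially"
  shows "(\<lambda>k. measure (line_kernel K (s k)) {0}) \<longlonglongrightarrow> measure (distr G borel (\<lambda>z. z)) {0}"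
proof -
  have eq: "measure (distr D borel (\<lambda>z. z)) {0} = measure D {0}" if "sets D = sets halfline" for D
  proof -
    note [measurable_cong] = that
    note [measurable] = halfline_id
    have "(\<lambda>z. z) -` {0} \<inter> space D = {0}"
      using sets_eq_imp_space_eq[OF that] by (auto simp: space_halfline)
    then show ?thesis by (subst measure_distr) auto
  qed
  have "((\<lambda>t. measure (K t) ((*) t ` {0..0})) \<longlongrightarrow> measure G {0}) at_top"
    using assms(1) by (simp add: extremal_boundary_def)
  then have "((\<lambda>t. measure (K t) {0}) \<longlongrightarrow> measure G {0}) at_top" by simp
  from filterlim_compose[OF this s]
  have "(\<lambda>k. measure (K (s k)) {0}) \<longlonglongrightarrow> measure G {0}" .
  moreover have "\<forall>\<^sub>F k in sequentially. measure (K (s k)) {0} = measure (line_kernel K (s k)) {0}"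
    using filterlim_at_top_dense[THEN iffD1, OF s, rule_format, of 0]
  proof eventually_elim
    case (elim k)
    then show ?case using eq[OF K_at(2), of "s k"] by (simp add: line_kernel_def max_def)
  qed
  ultimately show ?thesis
    unfolding eq[OF G_at(2)] by (rule Lim_transform_eventually)
qed

lemma markov_family_path_expectation:
  assumes P: "markov_family P K X" and "0 \<le> x"
    and f: "\<And>i. f i \<in> borel_measurable borel" "\<And>i z. f i z \<in> {0..1}"
  shows "(\<integral>\<omega>. (\<Prod>i<n. f i (X (Suc i) \<omega>)) \<partial>P x) = path_expectation (line_kernel K) n f x"
proof -
  from P \<open>0 \<le> x\<close> have chain: "markov_chain (P x) halfline K X" and X0: "AE \<omega> in P x. X 0 \<omega> = x"
    by (auto simp: markov_family_def)
  interpret prob_space "P x" by (rule prob_space_chain[OF chain K])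
  note [measurable] = measurable_chain[OF chain K] halfline_id
  have [measurable]: "path_expectation K n f \<in> borel_measurable halfline"
    by (rule measurable_path_expectation[OF K]) (rule halfline_to_borel[OF f(1)])
  have "(\<integral>\<omega>. (\<Prod>i<n. f i (X (Suc i) \<omega>)) \<partial>P x) = (\<integral>\<omega>. path_expectation K n f (X 0 \<omega>) \<partial>P x)"
    using markov_chain_path_expectation[OF chain K, of "\<lambda>_. 1" 0 f n] f by (simp add: halfline_to_borel)
  also have "\<dots> = (\<integral>\<omega>. path_expectation K n f x \<partial>P x)"
  proof (rule integral_cong_AE)
    show "AE \<omega> in P x. path_expectation K n f (X 0 \<omega>) = path_expectation K n f x"
      using X0 by eventually_elim simp
  qed measurable
  also have "\<dots> = path_expectation (line_kernel K) n f x"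
    using path_expectation_line_kernel[OF \<open>0 \<le> x\<close> f(1)] by (simp add: prob_space)
  finally show ?thesis .
qed

text \<open>Sequences tending to infinity suffice for a limit along the reals, and they are what
  Skorohod's theorem and dominated convergence require.\<close>

lemma finite_dimensional_convergence:
  fixes u :: "real \<Rightarrow> real" and f :: "nat \<Rightarrow> real \<Rightarrow> real"
  assumes doa: "in_domain_of_attraction K G" and P: "markov_family P K X" and Q: "tail_chain_family Q G T\<^sub>0 \<xi>"
    and alt: "extremal_boundary K G (\<lambda>_. 0) \<or> regularity_condition K"
    and u: "\<And>t. 0 \<le> t \<Longrightarrow> 0 \<le> u t" "0 < u\<^sub>0" "(u \<longlongrightarrow> u\<^sub>0) at_top"
    and f: "\<And>i. continuous_on UNIV (f i)" "\<And>i z. f i z \<in> {0..1}"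
  shows "((\<lambda>t. \<integral>\<omega>. (\<Prod>i<n. f i (X (Suc i) \<omega> / t)) \<partial>P (t * u t))
          \<longlongrightarrow> (\<integral>\<omega>. (\<Prod>i<n. f i (tail_chain T\<^sub>0 \<xi> (Suc i) \<omega>)) \<partial>Q u\<^sub>0)) at_top"
proof (rule tendsto_at_topI_sequentially)
  fix t :: "nat \<Rightarrow> real" assume t: "filterlim t at_top sequentially"
  interpret real_kernel "line_kernel K" "distr G borel (\<lambda>z. z)" by (rule real_kernel_line_kernel)
  have f_meas [measurable]: "f i \<in> borel_measurable borel" for i
    by (rule borel_measurable_continuous_onI[OF f(1)])
  \<comment> \<open>The finitely many scales below 1 are raised to 1, so that positivity holds for
    every k.\<close>
  define t' where "t' k = max 1 (t k)" for k
  have t'_eq: "\<forall>\<^sub>F k in sequentially. t' k = t k"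
    using filterlim_at_top_dense[THEN iffD1, OF t, rule_format, of 1] by eventually_elim (simp add: t'_def)
  have t'_pos: "0 < t' k" for k by (simp add: t'_def)
  have t'_lim: "filterlim t' at_top sequentially"
    using filterlim_cong[OF refl refl t'_eq] t by simp
  have "attracted_at_0 t'" if "regularity_condition K"
    unfolding attracted_at_0_def[OF t'_pos t'_lim] using regularity_weak_conv[OF that t'_pos t'_lim] by blast
  then have alt': "(\<forall>s. filterlim s at_top sequentially \<longrightarrow>
      (\<lambda>k. measure (line_kernel K (s k)) {0}) \<longlonglongrightarrow> measure (distr G borel (\<lambda>z. z)) {0}) \<or> attracted_at_0 t'"
    using alt zero_boundary_measure by blast
  have "(\<lambda>k. rescaled_expectation n f (t' k) (u (t' k))) \<longlonglongrightarrow> path_expectation (scaling_kernel (distr G borel (\<lambda>z. z))) n f u\<^sub>0"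
    by (rule rescaled_limit[OF t'_pos t'_lim attraction_weak_conv[OF doa] alt' f])
       (use u less_imp_le[OF t'_pos] filterlim_compose[OF u(3) t'_lim] in auto)
  also have "path_expectation (scaling_kernel (distr G borel (\<lambda>z. z))) n f u\<^sub>0
      = (\<integral>\<omega>. (\<Prod>i<n. f i (tail_chain T\<^sub>0 \<xi> (Suc i) \<omega>)) \<partial>Q u\<^sub>0)"
    using u(2) by (intro tail_chain_path_expectation[OF Q _ f_meas f(2), symmetric]) simp
  finally have "(\<lambda>k. rescaled_expectation n f (t' k) (u (t' k)))
      \<longlonglongrightarrow> (\<integral>\<omega>. (\<Prod>i<n. f i (tail_chain T\<^sub>0 \<xi> (Suc i) \<omega>)) \<partial>Q u\<^sub>0)" .
  then show "(\<lambda>k. \<integral>\<omega>. (\<Prod>i<n. f i (X (Suc i) \<omega> / t k)) \<partial>P (t k * u (t k)))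
      \<longlonglongrightarrow> (\<integral>\<omega>. (\<Prod>i<n. f i (tail_chain T\<^sub>0 \<xi> (Suc i) \<omega>)) \<partial>Q u\<^sub>0)"
  proof (rule Lim_transform_eventually)
    show "\<forall>\<^sub>F k in sequentially. rescaled_expectation n f (t' k) (u (t' k))
        = (\<integral>\<omega>. (\<Prod>i<n. f i (X (Suc i) \<omega> / t k)) \<partial>P (t k * u (t k)))"
      using t'_eq
    proof eventually_elim
      case (elim k)
      then have "0 < t k" using t'_pos[of k] by simp
      then show ?case
        unfolding elim rescaled_expectation_def using u(1)[of "t k"] f(2)
        by (intro markov_family_path_expectation[OF P, symmetric]) auto
    qed
  qed
qed

end

section \<open>The extremal component\<close>

lemma cts_step_eq_0: "a < b \<Longrightarrow> b \<le> z \<Longrightarrow> cts_step a b z = 0"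
  by (simp add: cts_step_def)

text \<open>Of \<open>\<rho>\<close> only the topology is known, so the comparison with
  coordinatewise distance is made uniform on a compact box. Two sequences in the box whose
  coordinates approach each other have a common limit along a subsequence, and there their
  \<open>\<rho>\<close>-distance tends to 0.\<close>

lemma compatible_metric_uniform:
  assumes \<rho>: "euclidean_compatible_metric m \<rho>" and "0 < \<epsilon>"
  shows "\<exists>\<delta>>0. \<forall>x\<in>{1..m} \<rightarrow>\<^sub>E {0..M}. \<forall>y\<in>{1..m} \<rightarrow>\<^sub>E {0..M}.
    (\<forall>i\<in>{1..m}. \<bar>x i - y i\<bar> \<le> \<delta>) \<longrightarrow> \<rho> x y \<le> \<epsilon>"
proof (rule ccontr)
  interpret Metric_space "{1..m} \<rightarrow>\<^sub>E (UNIV :: real set)" \<rho>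
    using \<rho> by (simp add: euclidean_compatible_metric_def)
  have top: "mtopology = product_topology (\<lambda>_. euclideanreal) {1..m}"
    using \<rho> by (simp add: euclidean_compatible_metric_def)
  let ?C = "{1..m} \<rightarrow>\<^sub>E {0..M}"
  assume "\<not> ?thesis"
  then have "\<forall>n. \<exists>x y. x \<in> ?C \<and> y \<in> ?C \<and> (\<forall>i\<in>{1..m}. \<bar>x i - y i\<bar> \<le> inverse (real (Suc n))) \<and> \<epsilon> < \<rho> x y"
    by (metis not_le inverse_positive_iff_positive of_nat_0_less_iff zero_less_Suc)
  then obtain x y where C: "\<And>n. x n \<in> ?C" "\<And>n. y n \<in> ?C"
    and close: "\<And>n i. i \<in> {1..m} \<Longrightarrow> \<bar>x n i - y n i\<bar> \<le> inverse (real (Suc n))"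
    and far: "\<And>n. \<epsilon> < \<rho> (x n) (y n)" by metis
  have "compactin mtopology ?C" unfolding top compactin_PiE by simp
  moreover have "range x \<subseteq> ?C" using C by auto
  ultimately obtain l r where l: "l \<in> ?C" "strict_mono r" "limitin mtopology (x \<circ> r) l sequentially"
    unfolding compactin_sequentially by meson
  have xl: "(\<lambda>n. x (r n) i) \<longlonglongrightarrow> l i" if "i \<in> {1..m}" for i
    using l(3) that unfolding top limitin_componentwise by (auto simp: comp_def)
  have "(\<lambda>n. y (r n) i) \<longlonglongrightarrow> l i" if "i \<in> {1..m}" for i
  proof -
    have "(\<lambda>n. x (r n) i - y (r n) i) \<longlonglongrightarrow> 0"
    proof (rule Lim_null_comparison)
      show "(\<lambda>n. inverse (real (Suc (r n)))) \<longlonglongrightarrow> 0"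
        using LIMSEQ_subseq_LIMSEQ[OF LIMSEQ_inverse_real_of_nat l(2)] by (simp add: comp_def)
    qed (use close that in auto)
    from tendsto_diff[OF xl[OF that] this] show ?thesis by simp
  qed
  then have yl: "limitin mtopology (y \<circ> r) l sequentially"
    unfolding top limitin_componentwise using C(2) l(1) by (auto simp: comp_def PiE_def)
  have near: "\<forall>\<^sub>F n in sequentially. \<rho> ((\<sigma> \<circ> r) n) l < \<epsilon> / 2" if "limitin mtopology (\<sigma> \<circ> r) l sequentially" for \<sigma>
  proof -
    have "\<forall>\<^sub>F n in sequentially. (\<sigma> \<circ> r) n \<in> ({1..m} \<rightarrow>\<^sub>E UNIV) \<and> \<rho> ((\<sigma> \<circ> r) n) l < \<epsilon> / 2"
      using that half_gt_zero[OF \<open>0 < \<epsilon>\<close>] unfolding limitin_metric by blast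
    then show ?thesis by (rule eventually_mono) blast
  qed
  from near[OF l(3)] near[OF yl] have "\<forall>\<^sub>F n in sequentially. False"
  proof eventually_elim
    case (elim n)
    have "\<rho> (x (r n)) (y (r n)) \<le> \<rho> (x (r n)) l + \<rho> l (y (r n))"
      using C l(1) by (intro triangle) (auto simp: PiE_def)
    with elim far[of "r n"] commute[of l "y (r n)"] show ?case unfolding comp_def by linarith
  qed
  then show False by simp
qed

section \<open>Sign, measurability and absorption at 0 of the tail chain; the extremal
  component\<close>

lemma tail_chain_nonneg:
  assumes "tail_chain_family Q G T\<^sub>0 \<xi>" "0 \<le> u" "\<omega> \<in> space (Q u)"
  shows "0 \<le> tail_chain T\<^sub>0 \<xi> i \<omega>"
proof -
  interpret prob_space "Q u" using assms by (simp add: tail_chain_family_def)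
  have ind: "indep_vars (\<lambda>_. halfline) (\<lambda>n. if n = 0 then T\<^sub>0 else \<xi> n) UNIV"
    using assms by (auto simp: tail_chain_family_def)
  have "(if n = 0 then T\<^sub>0 else \<xi> n) \<omega> \<in> {0..}" for n
    using ind measurable_space[of "if n = 0 then T\<^sub>0 else \<xi> n" "Q u" halfline \<omega>] assms(3)
    by (auto simp: indep_vars_def space_halfline)
  from this[of 0] this[of "Suc _"] have "0 \<le> T\<^sub>0 \<omega>" "0 \<le> \<xi> n \<omega>" if "n \<ge> 1" for n
    using that by (cases n; auto)+
  then show ?thesis unfolding tail_chain_def by (intro mult_nonneg_nonneg prod_nonneg) auto
qed

lemma tail_chain_measurable:
  assumes "tail_chain_family Q G T\<^sub>0 \<xi>" "0 \<le> u"
  shows "tail_chain T\<^sub>0 \<xi> i \<in> borel_measurable (Q u)"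
proof -
  interpret prob_space "Q u" using assms by (simp add: tail_chain_family_def)
  have "indep_vars (\<lambda>_. halfline) (\<lambda>n. if n = 0 then T\<^sub>0 else \<xi> n) UNIV"
    using assms by (auto simp: tail_chain_family_def)
  then have Y: "(if n = 0 then T\<^sub>0 else \<xi> n) \<in> Q u \<rightarrow>\<^sub>M halfline" for n
    by (auto simp: indep_vars_def)
  have "(if n = 0 then T\<^sub>0 else \<xi> n) \<in> borel_measurable (Q u)" for n
    using measurable_compose[OF Y halfline_id] .
  from this[of 0] this[of "Suc _"] have "T\<^sub>0 \<in> borel_measurable (Q u)" "\<xi> n \<in> borel_measurable (Q u)" if "n \<ge> 1" for n
    using that by (cases n; simp)+
  then show ?thesis unfolding tail_chain_def[abs_def] by (intro borel_measurable_times borel_measurable_prod) auto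
qed

lemma tail_chain_0_absorbing: "j \<le> i \<Longrightarrow> tail_chain T\<^sub>0 \<xi> j \<omega> = 0 \<Longrightarrow> tail_chain T\<^sub>0 \<xi> i \<omega> = 0"
  by (auto simp: tail_chain_def)

text \<open>A weak form that is enough below: a component killed at time i reveals a visit to the
  region below the boundary up to time i. The alternatives may overlap.\<close>

lemma extremal_component_cases:
  "extremal_component y X t i \<omega> = X i \<omega> \<or>
   extremal_component y X t i \<omega> = 0 \<and> (\<exists>n\<le>i. X n \<omega> \<le> t * y t)"
proof (cases "\<exists>n\<le>i. X n \<omega> \<le> t * y t")
  case False
  \<comment> \<open>With no visit up to time i, every time in the infimum is at least i + 1; this
    includes the empty set, where the time is \<infinity>.\<close>
  have "enat (Suc i) \<le> extremal_time y X t \<omega>"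
    unfolding extremal_time_def
  proof (rule Inf_greatest)
    fix k assume "k \<in> {enat n | n. X n \<omega> \<le> t * y t}"
    then obtain n where n: "k = enat n" "X n \<omega> \<le> t * y t" by blast
    with False have "\<not> n \<le> i" by blast
    with n show "enat (Suc i) \<le> k" by simp
  qed
  then have "enat i < extremal_time y X t \<omega>" by (rule less_le_trans[rotated]) simp
  then show ?thesis by (simp add: extremal_component_def)
next
  case True
  then show ?thesis
    by (cases "enat i < extremal_time y X t \<omega>") (auto simp: extremal_component_def)
qed

section \<open>The rescaled vector: convergence, tightness and no return from lower order\<close>

locale attracted_chain =
  fixes G :: "real measure" and K :: "real \<Rightarrow> real measure"
    and P :: "real \<Rightarrow> 'w measure" and X :: "nat \<Rightarrow> 'w \<Rightarrow> real"
    and Q :: "real \<Rightarrow> 'v measure" and T\<^sub>0 :: "'v \<Rightarrow> real" and \<xi> :: "nat \<Rightarrow> 'v \<Rightarrow> real"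
    and u :: "real \<Rightarrow> real" and u\<^sub>0 :: real and m :: nat
  assumes G: "G \<in> space (prob_algebra halfline)"
    and K: "K \<in> halfline \<rightarrow>\<^sub>M prob_algebra halfline"
    and doa: "in_domain_of_attraction K G"
    and P: "markov_family P K X" and Q: "tail_chain_family Q G T\<^sub>0 \<xi>"
    and alt: "extremal_boundary K G (\<lambda>_. 0) \<or> regularity_condition K"
    and u: "\<And>t. 0 \<le> t \<Longrightarrow> 0 \<le> u t" "0 < u\<^sub>0" "(u \<longlongrightarrow> u\<^sub>0) at_top"
begin

abbreviation "T \<equiv> tail_chain T\<^sub>0 \<xi>"

lemma chain: "0 \<le> t \<Longrightarrow> markov_chain (P (t * u t)) halfline K X" "0 \<le> t \<Longrightarrow> AE \<omega> in P (t * u t). X 0 \<omega> = t * u t"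
  using P u(1)[of t] by (auto simp: markov_family_def)

lemma prob_space_P: "0 \<le> t \<Longrightarrow> prob_space (P (t * u t))"
  by (rule prob_space_chain[OF chain(1) K])

lemma X_measurable: "0 \<le> t \<Longrightarrow> X i \<in> borel_measurable (P (t * u t))"
  using measurable_compose[OF measurable_chain[OF chain(1) K] halfline_id] .

lemma X_nonneg: "0 \<le> t \<Longrightarrow> \<omega> \<in> space (P (t * u t)) \<Longrightarrow> 0 \<le> X i \<omega>"
  using measurable_space[OF measurable_chain[OF chain(1) K]] by (auto simp: space_halfline)

lemma prob_space_Q: "prob_space (Q u\<^sub>0)"
  using Q u(2) by (auto simp: tail_chain_family_def)

lemma T_measurable: "T i \<in> borel_measurable (Q u\<^sub>0)"
  using tail_chain_measurable[OF Q] u(2) by simp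

lemma T_nonneg: "\<omega> \<in> space (Q u\<^sub>0) \<Longrightarrow> 0 \<le> T i \<omega>"
  using tail_chain_nonneg[OF Q, of u\<^sub>0 \<omega> i] u(2) by simp

lemma X_vector_measurable:
  "0 \<le> t \<Longrightarrow> (\<lambda>\<omega>. \<lambda>i\<in>{1..m}. ennreal (X i \<omega> / t)) \<in> P (t * u t) \<rightarrow>\<^sub>M (\<Pi>\<^sub>M i\<in>{1..m}. borel)"
  by (rule measurable_restrict)
     (intro measurable_compose[OF _ measurable_ennreal] borel_measurable_divide borel_measurable_const X_measurable)

lemma T_vector_measurable:
  "(\<lambda>\<omega>. \<lambda>i\<in>{1..m}. ennreal (T i \<omega>)) \<in> Q u\<^sub>0 \<rightarrow>\<^sub>M (\<Pi>\<^sub>M i\<in>{1..m}. borel)"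
  by (rule measurable_restrict) (rule measurable_compose[OF T_measurable measurable_ennreal])

lemma vector_convergence:
  "weak_convergence_on (product_topology (\<lambda>_. euclidean) {1..m})
     (\<lambda>t. distr (P (t * u t)) (\<Pi>\<^sub>M i\<in>{1..m}. borel) (\<lambda>\<omega>. \<lambda>i\<in>{1..m}. ennreal (X i \<omega> / t)))
     (distr (Q u\<^sub>0) (\<Pi>\<^sub>M i\<in>{1..m}. borel) (\<lambda>\<omega>. \<lambda>i\<in>{1..m}. ennreal (T i \<omega>))) at_top"
proof (rule weak_convergence_on_PiM_ennreal)
  show "\<forall>\<^sub>F t in at_top. prob_space (distr (P (t * u t)) (\<Pi>\<^sub>M i\<in>{1..m}. borel) (\<lambda>\<omega>. \<lambda>i\<in>{1..m}. ennreal (X i \<omega> / t))) \<and>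
      sets (distr (P (t * u t)) (\<Pi>\<^sub>M i\<in>{1..m}. borel) (\<lambda>\<omega>. \<lambda>i\<in>{1..m}. ennreal (X i \<omega> / t))) = sets (\<Pi>\<^sub>M i\<in>{1..m}. (borel :: ennreal measure))"
    using eventually_ge_at_top[of 0]
    by eventually_elim (intro conjI prob_space.prob_space_distr[OF prob_space_P X_vector_measurable] sets_distr)
  show "prob_space (distr (Q u\<^sub>0) (\<Pi>\<^sub>M i\<in>{1..m}. borel) (\<lambda>\<omega>. \<lambda>i\<in>{1..m}. ennreal (T i \<omega>)))"
    by (rule prob_space.prob_space_distr[OF prob_space_Q T_vector_measurable])
  fix g :: "nat \<Rightarrow> ennreal \<Rightarrow> real"
  assume g: "\<And>i. continuous_on UNIV (g i)" "\<And>i x. g i x \<in> {0..1}"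
  \<comment> \<open>Coordinates run over \<open>{1..m}\<close>, while path expectations number the
    steps from 0, hence the shift.\<close>
  define f where "f i z = g (Suc i) (ennreal z)" for i z
  have f: "continuous_on UNIV (f i)" "f i z \<in> {0..1}" for i z
    unfolding f_def
    by (rule continuous_on_compose2[OF g(1) continuous_on_ennreal[OF continuous_on_id]], simp) (rule g(2))
  have g_meas: "(\<lambda>x. \<Prod>i\<in>{1..m}. g i (x i)) \<in> borel_measurable (\<Pi>\<^sub>M i\<in>{1..m}. borel)"
  proof (rule borel_measurable_prod)
    fix i assume "i \<in> {1..m}"
    from measurable_compose[OF measurable_component_singleton[OF this] borel_measurable_continuous_onI[OF g(1)[of i]]]
    show "(\<lambda>x. g i (x i)) \<in> borel_measurable (\<Pi>\<^sub>M i\<in>{1..m}. borel)" .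
  qed
  have prod_shift: "(\<Prod>i\<in>{1..m}. g i ((\<lambda>i\<in>{1..m}. ennreal (z i)) i)) = (\<Prod>i<m. f i (z (Suc i)))" for z
  proof -
    have "(\<Prod>i\<in>{1..m}. h i) = (\<Prod>i<m. h (Suc i))" for h :: "nat \<Rightarrow> real"
      by (simp add: prod.atLeast1_atMost_eq)
    then show ?thesis unfolding f_def by (simp only:) (rule prod.cong, simp_all)
  qed
  have eq: "(\<integral>x. (\<Prod>i\<in>{1..m}. g i (x i)) \<partial>distr N (\<Pi>\<^sub>M i\<in>{1..m}. borel) (\<lambda>\<omega>. \<lambda>i\<in>{1..m}. ennreal (z i \<omega>)))
      = (\<integral>\<omega>. (\<Prod>i<m. f i (z (Suc i) \<omega>)) \<partial>N)"
    if "(\<lambda>\<omega>. \<lambda>i\<in>{1..m}. ennreal (z i \<omega>)) \<in> N \<rightarrow>\<^sub>M (\<Pi>\<^sub>M i\<in>{1..m}. borel)" for z and N :: "'n measure"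
    unfolding integral_distr[OF that g_meas] by (rule Bochner_Integration.integral_cong[OF refl prod_shift])
  have "\<forall>\<^sub>F t in at_top. (\<integral>\<omega>. (\<Prod>i<m. f i (X (Suc i) \<omega> / t)) \<partial>P (t * u t))
      = (\<integral>x. (\<Prod>i\<in>{1..m}. g i (x i)) \<partial>distr (P (t * u t)) (\<Pi>\<^sub>M i\<in>{1..m}. borel) (\<lambda>\<omega>. \<lambda>i\<in>{1..m}. ennreal (X i \<omega> / t)))"
    using eventually_ge_at_top[of 0] by eventually_elim (rule eq[OF X_vector_measurable, symmetric])
  with finite_dimensional_convergence[OF G K doa P Q alt u f]
  show "((\<lambda>t. \<integral>x. (\<Prod>i\<in>{1..m}. g i (x i)) \<partial>distr (P (t * u t)) (\<Pi>\<^sub>M i\<in>{1..m}. borel) (\<lambda>\<omega>. \<lambda>i\<in>{1..m}. ennreal (X i \<omega> / t)))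
      \<longlongrightarrow> (\<integral>x. (\<Prod>i\<in>{1..m}. g i (x i)) \<partial>distr (Q u\<^sub>0) (\<Pi>\<^sub>M i\<in>{1..m}. borel) (\<lambda>\<omega>. \<lambda>i\<in>{1..m}. ennreal (T i \<omega>)))) at_top"
    unfolding eq[OF T_vector_measurable] by (rule Lim_transform_eventually)
qed simp_all

text \<open>The product of two coordinate functions is a continuous test function on the power of
  [0,\<infinity>]. Tightness uses one coordinate (i = j with \<open>a\<close> constant), the
  no-return estimate two.\<close>

lemma pair_convergence:
  fixes a b :: "ennreal \<Rightarrow> real"
  assumes a: "continuous_on UNIV a" "\<And>z. a z \<in> {0..1}" and b: "continuous_on UNIV b" "\<And>z. b z \<in> {0..1}"
    and ij: "i \<in> {1..m}" "j \<in> {1..m}"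
  shows "((\<lambda>t. \<integral>\<omega>. a (ennreal (X j \<omega> / t)) * b (ennreal (X i \<omega> / t)) \<partial>P (t * u t))
    \<longlongrightarrow> (\<integral>\<omega>. a (ennreal (T j \<omega>)) * b (ennreal (T i \<omega>)) \<partial>Q u\<^sub>0)) at_top"
proof -
  let ?f = "\<lambda>x :: nat \<Rightarrow> ennreal. a (x j) * b (x i)"
  have f01: "?f x \<in> {0..1}" for x
    using a(2)[of "x j"] b(2)[of "x i"] by (simp add: mult_le_one)
  have coord: "continuous_map (product_topology (\<lambda>_. euclidean) {1..m}) euclideanreal (\<lambda>x. c (x k))"
    if "continuous_on UNIV c" "k \<in> {1..m}" for c :: "ennreal \<Rightarrow> real" and k
    using continuous_map_compose[OF continuous_map_product_projection[of k "{1..m}" "\<lambda>_. euclidean"], of euclideanreal c] that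
    by (simp add: comp_def)
  have "continuous_map (product_topology (\<lambda>_. euclidean) {1..m}) euclideanreal ?f"
    using a b ij by (intro continuous_map_real_mult coord)
  moreover have "bounded (?f ` topspace (product_topology (\<lambda>_. euclidean) {1..m}))"
    by (rule bounded_subset[OF bounded_closed_interval[of 0 1]]) (use f01 in auto)
  ultimately have lim: "((\<lambda>t. \<integral>x. ?f x \<partial>distr (P (t * u t)) (\<Pi>\<^sub>M i\<in>{1..m}. borel) (\<lambda>\<omega>. \<lambda>i\<in>{1..m}. ennreal (X i \<omega> / t)))
      \<longlongrightarrow> (\<integral>x. ?f x \<partial>distr (Q u\<^sub>0) (\<Pi>\<^sub>M i\<in>{1..m}. borel) (\<lambda>\<omega>. \<lambda>i\<in>{1..m}. ennreal (T i \<omega>)))) at_top"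
    using vector_convergence unfolding weak_convergence_on_def by blast
  have f_meas: "?f \<in> borel_measurable (\<Pi>\<^sub>M i\<in>{1..m}. borel)"
    by (rule borel_measurable_times[OF
          measurable_compose[OF measurable_component_singleton[OF ij(2)] borel_measurable_continuous_onI[OF a(1)]]
          measurable_compose[OF measurable_component_singleton[OF ij(1)] borel_measurable_continuous_onI[OF b(1)]]])
  have "(\<integral>x. ?f x \<partial>distr (Q u\<^sub>0) (\<Pi>\<^sub>M i\<in>{1..m}. borel) (\<lambda>\<omega>. \<lambda>i\<in>{1..m}. ennreal (T i \<omega>)))
      = (\<integral>\<omega>. a (ennreal (T j \<omega>)) * b (ennreal (T i \<omega>)) \<partial>Q u\<^sub>0)"
    using ij by (subst integral_distr[OF T_vector_measurable f_meas]) simp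
  moreover have "\<forall>\<^sub>F t in at_top. (\<integral>x. ?f x \<partial>distr (P (t * u t)) (\<Pi>\<^sub>M i\<in>{1..m}. borel) (\<lambda>\<omega>. \<lambda>i\<in>{1..m}. ennreal (X i \<omega> / t)))
      = (\<integral>\<omega>. a (ennreal (X j \<omega> / t)) * b (ennreal (X i \<omega> / t)) \<partial>P (t * u t))"
    using eventually_ge_at_top[of 0]
    by eventually_elim (use ij in \<open>subst integral_distr[OF X_vector_measurable f_meas], simp_all\<close>)
  ultimately show ?thesis using Lim_transform_eventually[OF lim] by simp
qed

lemma ramp_measurable:
  assumes "a < b" "c \<in> borel_measurable M"
  shows "(\<lambda>\<omega>. cts_step a b (c \<omega>)) \<in> borel_measurable M"
  by (rule measurable_compose[OF assms(2) borel_measurable_continuous_onI[OF continuous_on_cts_step[OF assms(1)]]])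

text \<open>The limit variables are finite, so a ramp that starts high enough has small expectation
  under the limit and hence, by weak convergence, under the chain; it dominates the indicator of the
  tail event.\<close>

lemma tightness:
  assumes "0 < e"
  shows "\<exists>M>0. \<forall>\<^sub>F t in at_top. (\<Sum>i\<in>{1..m}. measure (P (t * u t)) {\<omega> \<in> space (P (t * u t)). M * t < X i \<omega>}) < e"
proof -
  \<comment> \<open>This ramp is 0 up to n and 1 from n + 1 on, hence the threshold
    \<open>real n + 1\<close> below.\<close>
  let ?r = "\<lambda>n z. 1 - cts_step (real n) (real n + 1) z"
  interpret Q: prob_space "Q u\<^sub>0" by (rule prob_space_Q)
  have "(\<lambda>n. \<integral>\<omega>. ?r n (T i \<omega>) \<partial>Q u\<^sub>0) \<longlonglongrightarrow> (\<integral>\<omega>. 0 \<partial>Q u\<^sub>0)" for i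
  proof (rule integral_dominated_convergence[where w = "\<lambda>_. 1"])
    show "AE \<omega> in Q u\<^sub>0. (\<lambda>n. ?r n (T i \<omega>)) \<longlonglongrightarrow> 0"
    proof (rule AE_I2)
      fix \<omega>
      obtain N where "T i \<omega> < real N" using reals_Archimedean2 by blast
      then have "\<forall>\<^sub>F n in sequentially. ?r n (T i \<omega>) = 0"
        by (intro eventually_sequentiallyI[of N]) (simp add: cts_step_def)
      then show "(\<lambda>n. ?r n (T i \<omega>)) \<longlonglongrightarrow> 0" by (rule tendsto_eventually)
    qed
    show "AE \<omega> in Q u\<^sub>0. norm (?r n (T i \<omega>)) \<le> 1" for n
      using cts_step_range[of "real n" "real n + 1"] by auto
    show "(\<lambda>\<omega>. ?r n (T i \<omega>)) \<in> borel_measurable (Q u\<^sub>0)" for n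
      by (rule borel_measurable_diff[OF borel_measurable_const ramp_measurable[OF _ T_measurable]]) simp
  qed simp_all
  then have "(\<lambda>n. \<Sum>i\<in>{1..m}. \<integral>\<omega>. ?r n (T i \<omega>) \<partial>Q u\<^sub>0) \<longlonglongrightarrow> (\<Sum>i\<in>{1..m}. 0)"
    by (intro tendsto_sum) simp
  then have "\<forall>\<^sub>F n in sequentially. (\<Sum>i\<in>{1..m}. \<integral>\<omega>. ?r n (T i \<omega>) \<partial>Q u\<^sub>0) < e"
    by (rule order_tendstoD) (use \<open>0 < e\<close> in simp)
  then obtain n where n: "(\<Sum>i\<in>{1..m}. \<integral>\<omega>. ?r n (T i \<omega>) \<partial>Q u\<^sub>0) < e"
    by (auto simp: eventually_sequentially)
  let ?E = "\<lambda>z. 1 - ennreal_step (real n) (real n + 1) z"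
  have E: "continuous_on UNIV ?E" "?E z \<in> {0..1}" for z
    using ennreal_step_range[of "real n" "real n + 1" z]
    by (auto intro!: continuous_intros continuous_on_ennreal_step)
  have E_eq: "?E (ennreal z) = ?r n z" if "0 \<le> z" for z
    using ennreal_step_ennreal[of "real n" "real n + 1" z] that by simp
  have "((\<lambda>t. \<integral>\<omega>. ?E (ennreal (X i \<omega> / t)) \<partial>P (t * u t)) \<longlongrightarrow> (\<integral>\<omega>. ?r n (T i \<omega>) \<partial>Q u\<^sub>0)) at_top" if "i \<in> {1..m}" for i
  proof -
    have "(\<integral>\<omega>. ?E (ennreal (T i \<omega>)) \<partial>Q u\<^sub>0) = (\<integral>\<omega>. ?r n (T i \<omega>) \<partial>Q u\<^sub>0)"
      by (rule Bochner_Integration.integral_cong) (simp_all only: E_eq T_nonneg)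
    then show ?thesis
      using pair_convergence[of "\<lambda>_. 1" ?E i i, OF _ _ E that that] by simp
  qed
  then have "((\<lambda>t. \<Sum>i\<in>{1..m}. \<integral>\<omega>. ?E (ennreal (X i \<omega> / t)) \<partial>P (t * u t)) \<longlongrightarrow> (\<Sum>i\<in>{1..m}. \<integral>\<omega>. ?r n (T i \<omega>) \<partial>Q u\<^sub>0)) at_top"
    by (rule tendsto_sum)
  from order_tendstoD(2)[OF this n] eventually_gt_at_top[of 0]
  have "\<forall>\<^sub>F t in at_top. (\<Sum>i\<in>{1..m}. measure (P (t * u t)) {\<omega> \<in> space (P (t * u t)). (real n + 1) * t < X i \<omega>}) < e"
  proof eventually_elim
    case (elim t)
    interpret P: prob_space "P (t * u t)" by (rule prob_space_P) (use elim in simp)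
    have [measurable]: "X i \<in> borel_measurable (P (t * u t))" for i
      by (rule X_measurable) (use elim in simp)
    have [measurable]: "?E \<in> borel_measurable borel"
      by (rule borel_measurable_continuous_onI[OF E(1)])
    have "P.prob {\<omega> \<in> space (P (t * u t)). (real n + 1) * t < X i \<omega>} \<le> (\<integral>\<omega>. ?E (ennreal (X i \<omega> / t)) \<partial>P (t * u t))" for i
    proof -
      let ?A = "{\<omega> \<in> space (P (t * u t)). (real n + 1) * t < X i \<omega>}"
      have "P.prob ?A = (\<integral>\<omega>. indicator ?A \<omega> \<partial>P (t * u t))" by simp
      also have "\<dots> \<le> (\<integral>\<omega>. ?E (ennreal (X i \<omega> / t)) \<partial>P (t * u t))"
      proof (rule integral_mono)
        show "integrable (P (t * u t)) (indicator ?A :: _ \<Rightarrow> real)"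
          by (rule P.integrable_const_bound[of _ 1]) auto
        show "integrable (P (t * u t)) (\<lambda>\<omega>. ?E (ennreal (X i \<omega> / t)))"
          by (rule P.integrable_const_bound[of _ 1]) (use E(2) in auto)
        fix \<omega> assume "\<omega> \<in> space (P (t * u t))"
        then have "0 \<le> X i \<omega> / t" using X_nonneg[of t \<omega> i] elim by simp
        from E_eq[OF this] E(2)[of "ennreal (X i \<omega> / t)"]
        show "indicator ?A \<omega> \<le> ?E (ennreal (X i \<omega> / t))"
          using elim(2) by (auto simp: indicator_def cts_step_def field_simps)
      qed
      finally show ?thesis .
    qed
    then show ?case by (intro le_less_trans[OF sum_mono elim(1)])
  qed
  then show ?thesis by (intro exI[of _ "real n + 1"]) simp
qed

text \<open>The limit chain is absorbed at \<open>0\<close>, so the chain cannot be of order \<open>t\<close> after having been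
  of smaller order.\<close>

lemma no_return:
  assumes ij: "i \<in> {1..m}" "j \<in> {1..m}" "j \<le> i" and "0 < \<delta>" and y: "(y \<longlongrightarrow> 0) at_top"
  shows "((\<lambda>t. measure (P (t * u t)) {\<omega> \<in> space (P (t * u t)). X j \<omega> \<le> t * y t \<and> \<delta> * t < X i \<omega>}) \<longlongrightarrow> 0) at_top"
proof (rule tendstoI)
  fix e :: real assume "0 < e"
  \<comment> \<open>\<open>?a n\<close> is 1 up to 1/(n + 1) and 0 from 2/(n + 1) on;
    \<open>?b\<close> is 0 up to \<delta>/2 and 1 from \<delta> on. For the tail chain the product
    tends to 0 as n grows: a positive \<open>T j\<close> leaves the support of \<open>?a n\<close>,
    and if \<open>T j\<close> is 0 then so is \<open>T i\<close>, where \<open>?b\<close>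
    vanishes.\<close>
  let ?a = "\<lambda>n. cts_step (inverse (real (Suc n))) (2 * inverse (real (Suc n)))"
  let ?b = "\<lambda>z. 1 - cts_step (\<delta> / 2) \<delta> z"
  have lt: "inverse (real (Suc n)) < 2 * inverse (real (Suc n))" "\<delta> / 2 < \<delta>" for n using \<open>0 < \<delta>\<close> by auto
  interpret Q: prob_space "Q u\<^sub>0" by (rule prob_space_Q)
  have b01: "?b z \<in> {0..1}" for z using cts_step_range[OF lt(2), of z] by auto
  have "(\<lambda>n. \<integral>\<omega>. ?a n (T j \<omega>) * ?b (T i \<omega>) \<partial>Q u\<^sub>0) \<longlonglongrightarrow> (\<integral>\<omega>. 0 \<partial>Q u\<^sub>0)"
  proof (rule integral_dominated_convergence[where w = "\<lambda>_. 1"])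
    show "AE \<omega> in Q u\<^sub>0. (\<lambda>n. ?a n (T j \<omega>) * ?b (T i \<omega>)) \<longlonglongrightarrow> 0"
    proof (rule AE_I2)
      fix \<omega> assume \<omega>: "\<omega> \<in> space (Q u\<^sub>0)"
      show "(\<lambda>n. ?a n (T j \<omega>) * ?b (T i \<omega>)) \<longlonglongrightarrow> 0"
      proof (cases "T j \<omega> = 0")
        case True
        then have "T i \<omega> = 0" by (rule tail_chain_0_absorbing[OF ij(3)])
        then show ?thesis using \<open>0 < \<delta>\<close> by (simp add: cts_step_def)
      next
        case False
        then have "0 < T j \<omega>" using T_nonneg[OF \<omega>, of j] by simp
        moreover have "(\<lambda>n. 2 * inverse (real (Suc n))) \<longlonglongrightarrow> 2 * 0"
          by (intro tendsto_mult tendsto_const LIMSEQ_inverse_real_of_nat)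
        ultimately have "\<forall>\<^sub>F n in sequentially. 2 * inverse (real (Suc n)) < T j \<omega>"
          by (intro order_tendstoD(2)) auto
        then have "\<forall>\<^sub>F n in sequentially. ?a n (T j \<omega>) * ?b (T i \<omega>) = 0"
        proof eventually_elim
          case (elim n)
          have "?a n (T j \<omega>) = 0" by (rule cts_step_eq_0[OF lt(1) less_imp_le[OF elim]])
          then show ?case by (simp only: mult_zero_left)
        qed
        then show ?thesis by (rule tendsto_eventually)
      qed
    qed
    show "AE \<omega> in Q u\<^sub>0. norm (?a n (T j \<omega>) * ?b (T i \<omega>)) \<le> 1" for n
    proof (rule AE_I2)
      fix \<omega>
      show "norm (?a n (T j \<omega>) * ?b (T i \<omega>)) \<le> 1"
        using cts_step_range[OF lt(1)[of n], of "T j \<omega>"] b01[of "T i \<omega>"]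
        unfolding real_norm_def abs_mult by (intro mult_le_one) auto
    qed
    show "(\<lambda>\<omega>. ?a n (T j \<omega>) * ?b (T i \<omega>)) \<in> borel_measurable (Q u\<^sub>0)" for n
      by (rule borel_measurable_times[OF ramp_measurable[OF lt(1) T_measurable]
            borel_measurable_diff[OF borel_measurable_const ramp_measurable[OF lt(2) T_measurable]]])
  qed simp_all
  then have "\<forall>\<^sub>F n in sequentially. (\<integral>\<omega>. ?a n (T j \<omega>) * ?b (T i \<omega>) \<partial>Q u\<^sub>0) < e"
    by (rule order_tendstoD) (use \<open>0 < e\<close> in simp)
  then obtain n where n: "(\<integral>\<omega>. ?a n (T j \<omega>) * ?b (T i \<omega>) \<partial>Q u\<^sub>0) < e"
    by (auto simp: eventually_sequentially)
  \<comment> \<open>For large t the value \<open>y t\<close> is below \<open>\<eta>\<close>, and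
    then X j \<le> t y t puts X j / t where the first ramp is 1.\<close>
  define \<eta> where "\<eta> = inverse (real (Suc n))"
  have \<eta>: "0 < \<eta>" "\<eta> < 2 * \<eta>" by (simp_all add: \<eta>_def)
  let ?A = "ennreal_step \<eta> (2 * \<eta>)"
  let ?B = "\<lambda>z. 1 - ennreal_step (\<delta> / 2) \<delta> z"
  have A: "continuous_on UNIV ?A" "?A z \<in> {0..1}" for z
    using ennreal_step_range[OF \<eta>(2)] continuous_on_ennreal_step[OF \<eta>(2)] by auto
  have B: "continuous_on UNIV ?B" "?B z \<in> {0..1}" for z
    using ennreal_step_range[OF lt(2), of z] continuous_on_ennreal_step[OF lt(2)] by (auto intro!: continuous_intros)
  have eq: "?A (ennreal z) = cts_step \<eta> (2 * \<eta>) z" "?B (ennreal z) = ?b z" if "0 \<le> z" for z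
    using ennreal_step_ennreal[OF \<eta>(2) that] ennreal_step_ennreal[OF lt(2) that] by simp_all
  have "(\<integral>\<omega>. ?A (ennreal (T j \<omega>)) * ?B (ennreal (T i \<omega>)) \<partial>Q u\<^sub>0) = (\<integral>\<omega>. ?a n (T j \<omega>) * ?b (T i \<omega>) \<partial>Q u\<^sub>0)"
    unfolding \<eta>_def[symmetric] by (rule Bochner_Integration.integral_cong) (simp_all only: eq T_nonneg)
  with n have lim_lt: "(\<integral>\<omega>. ?A (ennreal (T j \<omega>)) * ?B (ennreal (T i \<omega>)) \<partial>Q u\<^sub>0) < e" by simp
  from order_tendstoD(2)[OF pair_convergence[OF A B ij(1,2)] lim_lt] order_tendstoD(2)[OF y \<eta>(1)] eventually_gt_at_top[of 0]
  show "\<forall>\<^sub>F t in at_top. dist (measure (P (t * u t)) {\<omega> \<in> space (P (t * u t)). X j \<omega> \<le> t * y t \<and> \<delta> * t < X i \<omega>}) 0 < e"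
  proof eventually_elim
    case (elim t)
    interpret P: prob_space "P (t * u t)" by (rule prob_space_P) (use elim in simp)
    have [measurable]: "X i \<in> borel_measurable (P (t * u t))" for i
      by (rule X_measurable) (use elim in simp)
    have [measurable]: "?A \<in> borel_measurable borel" "?B \<in> borel_measurable borel"
      by (rule borel_measurable_continuous_onI[OF A(1)], rule borel_measurable_continuous_onI[OF B(1)])
    let ?S = "{\<omega> \<in> space (P (t * u t)). X j \<omega> \<le> t * y t \<and> \<delta> * t < X i \<omega>}"
    have "P.prob ?S = (\<integral>\<omega>. indicator ?S \<omega> \<partial>P (t * u t))" by simp
    also have "\<dots> \<le> (\<integral>\<omega>. ?A (ennreal (X j \<omega> / t)) * ?B (ennreal (X i \<omega> / t)) \<partial>P (t * u t))"
    proof (rule integral_mono)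
      show "integrable (P (t * u t)) (indicator ?S :: _ \<Rightarrow> real)"
        by (rule P.integrable_const_bound[of _ 1]) auto
      show "integrable (P (t * u t)) (\<lambda>\<omega>. ?A (ennreal (X j \<omega> / t)) * ?B (ennreal (X i \<omega> / t)))"
      proof (rule P.integrable_const_bound[of _ 1])
        show "AE \<omega> in P (t * u t). norm (?A (ennreal (X j \<omega> / t)) * ?B (ennreal (X i \<omega> / t))) \<le> 1"
        proof (rule AE_I2)
          fix \<omega>
          show "norm (?A (ennreal (X j \<omega> / t)) * ?B (ennreal (X i \<omega> / t))) \<le> 1"
            using A(2)[of "ennreal (X j \<omega> / t)"] B(2)[of "ennreal (X i \<omega> / t)"]
            unfolding real_norm_def abs_mult by (intro mult_le_one) auto
        qed
      qed measurable
      fix \<omega> assume \<omega>: "\<omega> \<in> space (P (t * u t))"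
      have nn: "0 \<le> X k \<omega> / t" for k using X_nonneg[of t \<omega> k] \<omega> elim by simp
      show "indicator ?S \<omega> \<le> ?A (ennreal (X j \<omega> / t)) * ?B (ennreal (X i \<omega> / t))"
      proof (cases "\<omega> \<in> ?S")
        case True
        have "X j \<omega> \<le> t * \<eta>"
          using True mult_left_mono[of "y t" \<eta> t] elim(2,3) by (auto intro: order_trans)
        then have "X j \<omega> / t \<le> \<eta>" using elim(3) by (simp add: field_simps)
        moreover have "\<delta> \<le> X i \<omega> / t" using True elim(3) by (simp add: field_simps)
        ultimately have "cts_step \<eta> (2 * \<eta>) (X j \<omega> / t) = 1" "cts_step (\<delta> / 2) \<delta> (X i \<omega> / t) = 0"
          by (simp add: cts_step_def, intro cts_step_eq_0[OF lt(2)])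
        then show ?thesis
          unfolding eq[OF nn] by (simp add: indicator_def)
      next
        case False
        then show ?thesis using A(2)[of "ennreal (X j \<omega> / t)"] B(2)[of "ennreal (X i \<omega> / t)"] by simp
      qed
    qed
    finally show ?case using elim(1) by simp
  qed
qed

text \<open>Outside an event of small probability both vectors lie in the box [0,M]^m and differ by
  at most \<delta> in each coordinate. The exceptional event has three parts: the start is at or
  below the boundary, some state exceeds M t, or some X j with 1 \<le> j \<le> i is at most t y t
  while X i exceeds \<delta> t. \<open>M\<close> is chosen before \<delta>, which depends on the
  box.\<close>

lemma extremal_component_convergence:
  assumes \<rho>: "euclidean_compatible_metric m \<rho>" and y: "(y \<longlongrightarrow> 0) at_top" and "0 < \<epsilon>"
  shows "((\<lambda>t. \<P>(\<omega> in P (t * u t).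
      \<rho> (\<lambda>i\<in>{1..m}. extremal_component y X t i \<omega> / t) (\<lambda>i\<in>{1..m}. X i \<omega> / t) > \<epsilon>)) \<longlongrightarrow> 0) at_top"
proof (rule tendstoI)
  fix e :: real assume "0 < e"
  let ?p = "\<lambda>t. measure (P (t * u t))"
  let ?S = "\<lambda>t. space (P (t * u t))"
  obtain M where "0 < M" and M: "\<forall>\<^sub>F t in at_top. (\<Sum>i\<in>{1..m}. ?p t {\<omega> \<in> ?S t. M * t < X i \<omega>}) < e / 2"
    using tightness[of "e / 2"] \<open>0 < e\<close> by auto
  obtain \<delta> where "0 < \<delta>" and \<delta>: "\<forall>x\<in>{1..m} \<rightarrow>\<^sub>E {0..M}. \<forall>z\<in>{1..m} \<rightarrow>\<^sub>E {0..M}.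
      (\<forall>i\<in>{1..m}. \<bar>x i - z i\<bar> \<le> \<delta>) \<longrightarrow> \<rho> x z \<le> \<epsilon>"
    using compatible_metric_uniform[OF \<rho> \<open>0 < \<epsilon>\<close>, of M] by (elim exE conjE)
  have "((\<lambda>t. \<Sum>i\<in>{1..m}. \<Sum>j\<in>{1..i}. ?p t {\<omega> \<in> ?S t. X j \<omega> \<le> t * y t \<and> \<delta> * t < X i \<omega>})
      \<longlongrightarrow> (\<Sum>i\<in>{1..m}. \<Sum>j\<in>{1..i}. 0)) at_top"
    by (intro tendsto_sum no_return[OF _ _ _ \<open>0 < \<delta>\<close> y]) auto
  then have R: "\<forall>\<^sub>F t in at_top. (\<Sum>i\<in>{1..m}. \<Sum>j\<in>{1..i}. ?p t {\<omega> \<in> ?S t. X j \<omega> \<le> t * y t \<and> \<delta> * t < X i \<omega>}) < e / 2"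
    by (rule order_tendstoD) (use \<open>0 < e\<close> in simp)
  \<comment> \<open>The chain starts at \<open>t * u t\<close>, which is above the boundary
    \<open>t * y t\<close> for large t. This excludes a visit at time 0, a time that
    \<open>no_return\<close> does not cover.\<close>
  have "((\<lambda>t. u t - y t) \<longlongrightarrow> u\<^sub>0 - 0) at_top" by (rule tendsto_diff[OF u(3) y])
  then have "\<forall>\<^sub>F t in at_top. 0 < u t - y t" by (rule order_tendstoD) (use u(2) in simp)
  with M R show "\<forall>\<^sub>F t in at_top. dist (\<P>(\<omega> in P (t * u t).
      \<rho> (\<lambda>i\<in>{1..m}. extremal_component y X t i \<omega> / t) (\<lambda>i\<in>{1..m}. X i \<omega> / t) > \<epsilon>)) 0 < e"
    using eventually_gt_at_top[of 0]
  proof eventually_elim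
    case (elim t)
    interpret P: prob_space "P (t * u t)" by (rule prob_space_P) (use elim in simp)
    have [measurable]: "X i \<in> borel_measurable (P (t * u t))" for i
      by (rule X_measurable) (use elim in simp)
    let ?E = "{\<omega> \<in> ?S t. \<rho> (\<lambda>i\<in>{1..m}. extremal_component y X t i \<omega> / t) (\<lambda>i\<in>{1..m}. X i \<omega> / t) > \<epsilon>}"
    let ?A = "{\<omega> \<in> ?S t. X 0 \<omega> \<le> t * y t}"
    let ?B = "\<lambda>i. {\<omega> \<in> ?S t. M * t < X i \<omega>}"
    let ?C = "\<lambda>i j. {\<omega> \<in> ?S t. X j \<omega> \<le> t * y t \<and> \<delta> * t < X i \<omega>}"
    have sub: "?E \<subseteq> ?A \<union> ((\<Union>i\<in>{1..m}. ?B i) \<union> (\<Union>i\<in>{1..m}. \<Union>j\<in>{1..i}. ?C i j))"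
    proof (rule subsetI, rule ccontr)
      fix \<omega> assume \<omega>: "\<omega> \<in> ?E" and out: "\<omega> \<notin> ?A \<union> ((\<Union>i\<in>{1..m}. ?B i) \<union> (\<Union>i\<in>{1..m}. \<Union>j\<in>{1..i}. ?C i j))"
      have sp: "\<omega> \<in> ?S t" using \<omega> by simp
      have X_t: "0 \<le> X i \<omega> / t" for i using X_nonneg[OF _ sp] elim(4) by simp
      have X_M: "X i \<omega> / t \<le> M" if "i \<in> {1..m}" for i
      proof -
        have "X i \<omega> \<le> M * t" using out sp that by force
        then show ?thesis using elim(4) by (simp add: field_simps)
      qed
      \<comment> \<open>The component is untouched or killed. If killed, the visit happened at some
        time n between 1 and i, and avoiding \<open>?C i n\<close> bounds the original
        value.\<close>
      have ext: "extremal_component y X t i \<omega> / t = X i \<omega> / t \<or>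
          extremal_component y X t i \<omega> / t = 0 \<and> X i \<omega> / t \<le> \<delta>" if "i \<in> {1..m}" for i
        using extremal_component_cases[of y X t i \<omega>]
      proof
        assume *: "extremal_component y X t i \<omega> = 0 \<and> (\<exists>n\<le>i. X n \<omega> \<le> t * y t)"
        then obtain n where n: "n \<le> i" "X n \<omega> \<le> t * y t" by blast
        have "n \<noteq> 0" using n out sp by force
        then have "\<omega> \<notin> ?C i n" using out n that by force
        then have "X i \<omega> \<le> \<delta> * t" using n sp by force
        then have "X i \<omega> / t \<le> \<delta>" using elim(4) by (simp add: field_simps)
        with * show ?thesis by simp
      qed simp
      have "\<rho> (\<lambda>i\<in>{1..m}. extremal_component y X t i \<omega> / t) (\<lambda>i\<in>{1..m}. X i \<omega> / t) \<le> \<epsilon>"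
      proof (rule \<delta>[THEN bspec, THEN bspec, THEN mp])
        show "(\<lambda>i\<in>{1..m}. extremal_component y X t i \<omega> / t) \<in> {1..m} \<rightarrow>\<^sub>E {0..M}"
        proof (rule restrict_PiE_iff[THEN iffD2], rule ballI)
          fix i assume "i \<in> {1..m}"
          then show "extremal_component y X t i \<omega> / t \<in> {0..M}"
            using ext[of i] X_t[of i] X_M[of i] \<open>0 < M\<close> by auto
        qed
        show "(\<lambda>i\<in>{1..m}. X i \<omega> / t) \<in> {1..m} \<rightarrow>\<^sub>E {0..M}"
          using X_t X_M by auto
        show "\<forall>i\<in>{1..m}. \<bar>(\<lambda>i\<in>{1..m}. extremal_component y X t i \<omega> / t) i - (\<lambda>i\<in>{1..m}. X i \<omega> / t) i\<bar> \<le> \<delta>"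
        proof
          fix i assume "i \<in> {1..m}"
          then show "\<bar>(\<lambda>i\<in>{1..m}. extremal_component y X t i \<omega> / t) i - (\<lambda>i\<in>{1..m}. X i \<omega> / t) i\<bar> \<le> \<delta>"
            using ext[of i] X_t[of i] \<open>0 < \<delta>\<close> by auto
        qed
      qed
      with \<omega> show False by simp
    qed
    have "AE \<omega> in P (t * u t). \<not> X 0 \<omega> \<le> t * y t"
      using chain(2)[of t]
    proof (rule AE_mp, goal_cases)
      case 2
      then show ?case using elim(3,4) by (intro AE_I2) simp
    qed (use elim(4) in simp)
    then have A0: "P.prob ?A = 0" by (subst P.prob_eq_0) auto
    have A: "?A \<in> P.events" and B: "?B i \<in> P.events" and C: "?C i j \<in> P.events" for i j by measurable
    have UB: "(\<Union>i\<in>{1..m}. ?B i) \<in> P.events" and UC: "(\<Union>j\<in>{1..i}. ?C i j) \<in> P.events" for i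
      using B C by (intro sets.finite_UN finite_atLeastAtMost; simp)+
    have UUC: "(\<Union>i\<in>{1..m}. \<Union>j\<in>{1..i}. ?C i j) \<in> P.events"
      by (rule sets.finite_UN[OF finite_atLeastAtMost UC])
    \<comment> \<open>Monotonicity asks for measurability of the larger set only, so that of
      \<open>?E\<close> is not an issue.\<close>
    have "P.prob ?E \<le> P.prob (?A \<union> ((\<Union>i\<in>{1..m}. ?B i) \<union> (\<Union>i\<in>{1..m}. \<Union>j\<in>{1..i}. ?C i j)))"
      by (rule P.finite_measure_mono[OF sub sets.Un[OF A sets.Un[OF UB UUC]]])
    also have "\<dots> \<le> P.prob ?A + P.prob ((\<Union>i\<in>{1..m}. ?B i) \<union> (\<Union>i\<in>{1..m}. \<Union>j\<in>{1..i}. ?C i j))"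
      by (rule measure_Un_le[OF A sets.Un[OF UB UUC]])
    finally have 1: "P.prob ?E \<le> P.prob ?A + P.prob ((\<Union>i\<in>{1..m}. ?B i) \<union> (\<Union>i\<in>{1..m}. \<Union>j\<in>{1..i}. ?C i j))" .
    have 2: "P.prob ((\<Union>i\<in>{1..m}. ?B i) \<union> (\<Union>i\<in>{1..m}. \<Union>j\<in>{1..i}. ?C i j))
        \<le> P.prob (\<Union>i\<in>{1..m}. ?B i) + P.prob (\<Union>i\<in>{1..m}. \<Union>j\<in>{1..i}. ?C i j)"
      by (rule measure_Un_le[OF UB UUC])
    have 3: "P.prob (\<Union>i\<in>{1..m}. ?B i) \<le> (\<Sum>i\<in>{1..m}. P.prob (?B i))"
      by (rule P.finite_measure_subadditive_finite[OF finite_atLeastAtMost image_subsetI[OF B]])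
    have "P.prob (\<Union>i\<in>{1..m}. \<Union>j\<in>{1..i}. ?C i j) \<le> (\<Sum>i\<in>{1..m}. P.prob (\<Union>j\<in>{1..i}. ?C i j))"
      by (rule P.finite_measure_subadditive_finite[OF finite_atLeastAtMost image_subsetI[OF UC]])
    also have "\<dots> \<le> (\<Sum>i\<in>{1..m}. \<Sum>j\<in>{1..i}. P.prob (?C i j))"
      by (rule sum_mono, rule P.finite_measure_subadditive_finite[OF finite_atLeastAtMost image_subsetI[OF C]])
    finally have "P.prob ?E < e" using A0 elim(1,2) 1 2 3 by linarith
    then show ?case by simp
  qed
qed

end

theorem theorem4p1:
  fixes G :: "real measure"
    and K :: "real \<Rightarrow> real measure"
    and P :: "real \<Rightarrow> 'w measure"
    and X :: "nat \<Rightarrow> 'w \<Rightarrow> real"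
    and Q :: "real \<Rightarrow> 'v measure"
    and T\<^sub>0 :: "'v \<Rightarrow> real"
    and \<xi> :: "nat \<Rightarrow> 'v \<Rightarrow> real"
    and y :: "real \<Rightarrow> real"
    and m :: nat
    and \<rho> :: "(nat \<Rightarrow> real) \<Rightarrow> (nat \<Rightarrow> real) \<Rightarrow> real"
  assumes "G \<in> space (prob_algebra halfline)"
    and "K \<in> halfline \<rightarrow>\<^sub>M prob_algebra halfline"
    and "in_domain_of_attraction K G"
    and "markov_family P K X"
    and "tail_chain_family Q G T\<^sub>0 \<xi>"
    and "uniform_extremal_boundary K G y"
    and "m \<ge> 1"
    and "euclidean_compatible_metric m \<rho>"
    and "extremal_boundary K G (\<lambda>_. 0) \<or> regularity_condition K"
  shows "(\<forall>\<epsilon>>0. \<forall>u u\<^sub>0. (\<forall>t\<ge>0. 0 \<le> u t) \<and> 0 < u\<^sub>0 \<and> (u \<longlongrightarrow> u\<^sub>0) at_top \<longrightarrow>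
            ((\<lambda>t. \<P>(\<omega> in P (t * u t).
                 \<rho> (\<lambda>i\<in>{1..m}. extremal_component y X t i \<omega> / t) (\<lambda>i\<in>{1..m}. X i \<omega> / t) > \<epsilon>))
              \<longlongrightarrow> 0) at_top)
       \<and> (\<forall>u u\<^sub>0. (\<forall>t\<ge>0. 0 \<le> u t) \<and> 0 < u\<^sub>0 \<and> (u \<longlongrightarrow> u\<^sub>0) at_top \<longrightarrow>
            weak_convergence_on (product_topology (\<lambda>_. euclidean) {1..m})
              (\<lambda>t. distr (P (t * u t)) (\<Pi>\<^sub>M i\<in>{1..m}. borel)
                     (\<lambda>\<omega>. \<lambda>i\<in>{1..m}. ennreal (X i \<omega> / t)))
              (distr (Q u\<^sub>0) (\<Pi>\<^sub>M i\<in>{1..m}. borel)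
                 (\<lambda>\<omega>. \<lambda>i\<in>{1..m}. ennreal (tail_chain T\<^sub>0 \<xi> i \<omega>)))
              at_top)"
proof -
  have y: "(y \<longlongrightarrow> 0) at_top"
    using assms(6) by (simp add: uniform_extremal_boundary_def extremal_boundary_def)
  have attracted: "attracted_chain G K P X Q T\<^sub>0 \<xi> u u\<^sub>0"
    if "(\<forall>t\<ge>0. 0 \<le> u t) \<and> 0 < u\<^sub>0 \<and> (u \<longlongrightarrow> u\<^sub>0) at_top" for u u\<^sub>0
    by (rule attracted_chain.intro[OF assms(1-5) assms(9)]) (use that in simp_all)
  show ?thesis
    by (intro conjI allI impI)
       (rule attracted_chain.extremal_component_convergence[OF attracted assms(8) y]
          attracted_chain.vector_convergence[OF attracted]; assumption)+
qed

end
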